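(* Let $\ell\in\mathbb N$, let $(G,+)$ be a countably infinite abelian group and let $(X,\mathcal A,\mu,(T_g)_{g\in G})$ be a measure preserving system. The following statements are equivalent: (i) $(T_g)_{g\in G}$ is weakly mixing. (ii) For any Følner sequence $(F_k)_{k\in\mathbb N}$ in $G^\ell$, any set $E\subseteq G^\ell$ with $\overline d_{(F_k)}(E)>0$ and any $m\in\mathbb N$, there exist non-degenerated and essentially distinct sequences $(\mathbf g^{(j)}_k)_{k\in\mathbb N}=(g^{(j)}_{k,1},\dots,g^{(j)}_{k,m})_{k\in\mathbb N}$, $j\in\{1,\dots,\ell\}$, in $G^m$ with the properties: (a) $\{(g^{(1)}_\alpha,\dots,g^{(\ell)}_\alpha) : \alpha\in\mathbb N^{(m)}\}\subseteq E$; (b) for any $t\in\{1,\dots,m\}$ and any $j\in\{1,\dots,\ell\}$, $(T_{g^{(j)}_{k,t}})_{k\in\mathbb N}$ has the mixing property; (c) for any $t\in\{1,\dots,m\}$ and any $i\neq j$, $(T_{g^{(j)}_{k,t}-g^{(i)}_{k,t}})_{k\in\mathbb N}$ has the mixing property. (iii) For any Følner sequence $(F_k)_{k\in\mathbb N}$ in $G^\ell$ and any set $E\subseteq G^\ell$ with $\overline d_{(F_k)}(E)>0$, there exist an $m\in\mathbb N$ and sequences $(\mathbf g^{(1)}_k)_{k\in\mathbb N},\dots,(\mathbf g^{(\ell)}_k)_{k\in\mathbb N}$ in $G^m$ with $\{(g^{(1)}_\alpha,\dots,g^{(\ell)}_\alpha) : \alpha\in\mathbb N^{(m)}\}\subseteq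 E$ and such that for any $A_0,\dots,A_\ell\in\mathcal A$, $$\mathop{\mathcal R\text{-}\lim}_{\alpha\in\mathbb N^{(m)}}\mu\big(A_0\cap T_{g^{(1)}_\alpha}A_1\cap\cdots\cap T_{g^{(\ell)}_\alpha}A_\ell\big)=\prod_{j=0}^\ell\mu(A_j).$$ (iv) For any $A_0,\dots,A_\ell\in\mathcal A$ and any $\epsilon>0$, the set $$R_\epsilon(A_0,\dots,A_\ell)=\Big\{(g_1,\dots,g_\ell)\in G^\ell : \Big|\mu(A_0\cap T_{g_1}A_1\cap\cdots\cap T_{g_\ell}A_\ell)-\prod_{j=0}^\ell\mu(A_j)\Big|<\epsilon\Big\}$$ has uniform density one.
   Context: $\mathbb N=\{1,2,\dots\}$. A measure preserving system $(X,\mathcal A,\mu,(T_g)_{g\in G})$ consists of a separable probability space and an action of the countable discrete abelian group $G$ on it by (invertible) $\mu$-preserving transformations; as a standing assumption the space is regular, i.e. $X$ is a compact metric space and $\mathcal A=\mathrm{Borel}(X)$. The action is weakly mixing if the diagonal action $(T_g\times T_g)_{g\in G}$ on $(X\times X,\mathcal A\otimes\mathcal A,\mu\otimes\mu)$ is ergodic. $\lim_{k\to\infty}g_k=\infty$ in $G$ means that for every finite $F\subseteq G$, $g_k\notin F$ for all large $k$. A Følner sequence in a countable abelian group $\Gamma$ is a sequence $(F_k)_{k\in\mathbb N}$ of non-empty finite subsets of $\Gamma$ with $\lim_{k\to\infty}|(g+F_k)\cap F_k|/|F_k|=1$ for every $g\in\Gamma$. For $E\subseteq\Gamma$, $\overline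 d_{(F_k)}(E)=\limsup_{k\to\infty}|E\cap F_k|/|F_k|$. $E\subseteq\Gamma$ has uniform density one if $\overline d_{(F_k)}(E)=1$ for every Følner sequence $(F_k)$ in $\Gamma$. A sequence $(T_k)_{k\in\mathbb N}$ of measure preserving transformations of $(X,\mathcal A,\mu)$ has the mixing property if $\lim_{k\to\infty}\mu(A_0\cap T_k^{-1}A_1)=\mu(A_0)\mu(A_1)$ for all $A_0,A_1\in\mathcal A$. Sequences in $G^m$: $(g_{k,1},\dots,g_{k,m})_{k\in\mathbb N}$ is non-degenerated if $\lim_{k\to\infty}g_{k,t}=\infty$ for each $t$; two sequences $(g_{k,1},\dots,g_{k,m})_k$, $(h_{k,1},\dots,h_{k,m})_k$ are essentially distinct if $\lim_{k\to\infty}(g_{k,t}-h_{k,t})=\infty$ for each $t$; several are essentially distinct if any two with distinct indices are. $\mathbb N^{(m)}$ is the family of $m$-element subsets of $\mathbb N$, and for $\alpha=\{k_1<\cdots<k_m\}\in\mathbb N^{(m)}$ and a sequence $(g_{k,1},\dots,g_{k,m})_k$ in $G^m$, $g_\alpha=g_{k_1,1}+\cdots+g_{k_m,m}$. For $(x_\alpha)_{\alpha\in\mathbb N^{(m)}}$ in a compact metric space $(Y,d)$, $\mathcal R\text{-}\lim_{\alpha\in\mathbb N^{(m)}}x_\alpha=x$ means: for every $\epsilon>0$ there is $\alpha_0\in\mathbb N^{(m)}$ with $d(x_\alpha,x)<\epsilon$ for all $\alpha\in\mathbb N^{(m)}$ with $\min\alpha>\max\alpha_0$. *)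

theory Defs
  imports "HOL-Probability.Probability"
begin

(* The index set of all sequences is {1,2,...}; values at index 0 are never referred to,
   except in limits as k tends to infinity, where they are irrelevant. *)

locale mp_system = prob_space M
  for M :: "'x::metric_space measure" +
  fixes T :: "'g::ab_group_add \<Rightarrow> 'x \<Rightarrow> 'x"
  assumes compact_space: "compact (space M)"
    and sets_borel: "sets M = sets (restrict_space borel (space M))"
    and T_measurable: "T g \<in> measurable M M"
    and T_preserving: "A \<in> sets M \<Longrightarrow> emeasure M (T g -` A \<inter> space M) = emeasure M A"
    and T_zero: "x \<in> space M \<Longrightarrow> T 0 x = x"
    and T_add: "x \<in> space M \<Longrightarrow> T (g + h) x = T g (T h x)"

definition ergodic_action :: "'x measure \<Rightarrow> ('g \<Rightarrow> 'x \<Rightarrow> 'x) \<Rightarrow> bool" where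
  "ergodic_action M T \<longleftrightarrow>
     (\<forall>A\<in>sets M. (\<forall>g. T g -` A \<inter> space M = A) \<longrightarrow> measure M A = 0 \<or> measure M A = 1)"

definition weakly_mixing :: "'x measure \<Rightarrow> ('g \<Rightarrow> 'x \<Rightarrow> 'x) \<Rightarrow> bool" where
  "weakly_mixing M T \<longleftrightarrow> ergodic_action (M \<Otimes>\<^sub>M M) (\<lambda>g. map_prod (T g) (T g))"

definition mixing_property :: "'x measure \<Rightarrow> (nat \<Rightarrow> 'x \<Rightarrow> 'x) \<Rightarrow> bool" where
  "mixing_property M S \<longleftrightarrow>
     (\<forall>A0\<in>sets M. \<forall>A1\<in>sets M.
        (\<lambda>k. measure M (A0 \<inter> (S k -` A1 \<inter> space M))) \<longlonglongrightarrow> measure M A0 * measure M A1)"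

definition tends_to_infinity :: "(nat \<Rightarrow> 'g) \<Rightarrow> bool" where
  "tends_to_infinity g \<longleftrightarrow> (\<forall>F. finite F \<longrightarrow> (\<forall>\<^sub>F k in sequentially. g k \<notin> F))"

definition folner_seq :: "(nat \<Rightarrow> 'a::ab_group_add set) \<Rightarrow> bool" where
  "folner_seq F \<longleftrightarrow>
     (\<forall>k\<ge>1. finite (F k) \<and> F k \<noteq> {}) \<and>
     (\<forall>g. (\<lambda>k. real (card ((+) g ` F k \<inter> F k)) / real (card (F k))) \<longlonglongrightarrow> 1)"

definition upper_density :: "(nat \<Rightarrow> 'a set) \<Rightarrow> 'a set \<Rightarrow> ereal" where
  "upper_density F E = limsup (\<lambda>k. ereal (real (card (E \<inter> F k)) / real (card (F k))))"

definition uniform_density_one :: "'a::ab_group_add set \<Rightarrow> bool" where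
  "uniform_density_one E \<longleftrightarrow> (\<forall>F. folner_seq F \<longrightarrow> upper_density F E = 1)"

(* A sequence (g_{k,1},...,g_{k,m})_k in G^m is encoded as g :: nat => nat => 'g, where
   g k t is the t-th coordinate of the k-th term and only t in {1..m} is relevant. *)

definition non_degenerated :: "nat \<Rightarrow> (nat \<Rightarrow> nat \<Rightarrow> 'g) \<Rightarrow> bool" where
  "non_degenerated m g \<longleftrightarrow> (\<forall>t\<in>{1..m}. tends_to_infinity (\<lambda>k. g k t))"

definition essentially_distinct ::
  "nat \<Rightarrow> (nat \<Rightarrow> nat \<Rightarrow> 'g::ab_group_add) \<Rightarrow> (nat \<Rightarrow> nat \<Rightarrow> 'g) \<Rightarrow> bool" where
  "essentially_distinct m g h \<longleftrightarrow> (\<forall>t\<in>{1..m}. tends_to_infinity (\<lambda>k. g k t - h k t))"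

definition msubsets :: "nat \<Rightarrow> nat set set" where
  "msubsets m = {\<alpha>. \<alpha> \<subseteq> {1..} \<and> finite \<alpha> \<and> card \<alpha> = m}"

(* For \<alpha> = {k_1 < ... < k_m}, the list entry with (0-based) position t - 1 is k_t. *)
definition set_sum :: "nat \<Rightarrow> (nat \<Rightarrow> nat \<Rightarrow> 'g::ab_group_add) \<Rightarrow> nat set \<Rightarrow> 'g" where
  "set_sum m g \<alpha> = (\<Sum>t=1..m. g (sorted_list_of_set \<alpha> ! (t - 1)) t)"

definition R_lim :: "nat \<Rightarrow> (nat set \<Rightarrow> 'y::metric_space) \<Rightarrow> 'y \<Rightarrow> bool" where
  "R_lim m x L \<longleftrightarrow>
     (\<forall>\<epsilon>>0. \<exists>\<alpha>0\<in>msubsets m. \<forall>\<alpha>\<in>msubsets m. Min \<alpha> > Max \<alpha>0 \<longrightarrow> dist (x \<alpha>) L < \<epsilon>)"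

(* G^l is the type 'g^'l with componentwise addition, where l = CARD('l);
   A0 and A j for j :: 'l are the sets A_0 and A_1, ..., A_l. *)

definition multi_corr ::
  "'x measure \<Rightarrow> ('g \<Rightarrow> 'x \<Rightarrow> 'x) \<Rightarrow> 'x set \<Rightarrow> ('l::finite \<Rightarrow> 'x set) \<Rightarrow> 'g^'l \<Rightarrow> real" where
  "multi_corr M T A0 A g = measure M (A0 \<inter> (\<Inter>j\<in>UNIV. T (g $ j) ` A j))"

definition R_set ::
  "'x measure \<Rightarrow> ('g \<Rightarrow> 'x \<Rightarrow> 'x) \<Rightarrow> real \<Rightarrow> 'x set \<Rightarrow> ('l::finite \<Rightarrow> 'x set) \<Rightarrow> ('g^'l) set" where
  "R_set M T \<epsilon> A0 A =
     {g. \<bar>multi_corr M T A0 A g - measure M A0 * (\<Prod>j\<in>UNIV. measure M (A j))\<bar> < \<epsilon>}"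

end

theory Submission
  imports Defs
begin

text \<open>
  For independent group elements \<open>g\<^sub>1, \<dots>, g\<^sub>l\<close>, higher order mixing on average costs no more than
  ergodicity. Average the correlation \<open>c(g) = \<mu>(A\<^sub>0 \<inter> T\<^bsub>g\<^sub>1\<^esub> A\<^sub>1 \<inter> \<dots> \<inter> T\<^bsub>g\<^sub>l\<^esub> A\<^sub>l)\<close> along a Folner sequence of
  \<open>G\<^sup>l\<close> and pass to a limit functional of \<open>(A\<^sub>1, \<dots>, A\<^sub>l)\<close>. Moving only the \<open>j\<close>-th group element moves only
  the \<open>j\<close>-th set, so in each single coordinate the limit is an invariant set function dominated
  by \<open>\<mu>\<close>. If \<open>T\<close> is ergodic, such a set function is a multiple of \<open>\<mu>\<close>
  (\<open>ergodic_invariant_set_function\<close>). The coordinates factor out one after the other, and the averages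
  of \<open>c\<close> tend to the product \<open>p\<close> of the measures (\<open>ergodic_average_multi_corr\<close>).

  Weak mixing is ergodicity of the product system, whose correlations of squares of sets
  are \<open>c\<^sup>2\<close>. So the averages of \<open>c\<close> and of \<open>c\<^sup>2\<close> tend to \<open>p\<close> and \<open>p\<^sup>2\<close>, the averages of \<open>(c - p)\<^sup>2\<close> tend to
  zero, and by Chebyshev's inequality \<open>c\<close> is close to \<open>p\<close> on a set of density one along every Folner
  sequence (\<open>weakly_mixing_imp_R_set_full_density\<close>). This is (i) \<open>\<Longrightarrow>\<close> (iv).

  The space is compact metric, so a countable family of sets decides whether all
  correlations converge along a sequence. Membership of the \<open>k\<close>-th term in a suitable set \<open>D\<^sub>k\<close> of full
  density, for all \<open>k\<close>, therefore implies such convergence (\<open>mixing_test_sets\<close>). A set \<open>E\<close> of positive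
  upper density meets every \<open>D\<^sub>k\<close>, which gives (iii) with \<open>m = 1\<close>.

  For (ii) the terms must be chosen from the \<open>D\<^sub>k\<close> in such a way that all sums over \<open>m\<close>-element index
  sets lie in \<open>E\<close>. Bergelson's intersectivity argument, carried out for a finitely additive
  invariant mean, yields a set \<open>E'\<close> of positive upper density for which finitely many points of \<open>E'\<close>
  can always be translated into \<open>E\<close> simultaneously by an element of any given set of full density
  (\<open>positive_upper_density_intersectivity\<close>). Induction on \<open>m\<close>, applied to \<open>E'\<close>, does the rest
  (\<open>positive_upper_density_contains_sums\<close>).

  Conversely, each of (ii), (iii), (iv), applied to the whole group \<open>G\<^sup>l\<close> (which has a Folner sequence,
  because finitely generated abelian groups have polynomial growth), produces one sequence along which
  \<open>T\<close> is mixing. Then \<open>T \<times> T\<close> is mixing along this sequence, and an invariant set \<open>W\<close> of \<open>T \<times> T\<close>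
  has measure equal to the square of its measure (\<open>mixing_sequence_imp_weakly_mixing\<close>).
\<close>

section \<open>Limit functionals along finer filters\<close>

text \<open>
  Tychonoff's theorem for a product of compact intervals, with one factor for each index. The index
  type may be uncountable, so in general only a finer filter, and no subsequence, makes all
  coordinates converge.
\<close>
lemma cluster_functional:
  fixes \<Phi> :: "nat \<Rightarrow> 'i \<Rightarrow> real"
  assumes "\<And>k i. \<bar>\<Phi> k i\<bar> \<le> 1" and "V \<noteq> bot"
  shows "\<exists>U L. U \<le> V \<and> U \<noteq> bot \<and> (\<forall>i. ((\<lambda>k. \<Phi> k i) \<longlongrightarrow> L i) U)"
proof -
  have "compactin (product_topology (\<lambda>i::'i. euclidean) UNIV) (PiE UNIV (\<lambda>i. {-1..1::real}))"
    by (subst compactin_PiE) auto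
  then have "compact (PiE (UNIV :: 'i set) (\<lambda>i. {-1..1::real}))"
    by (simp add: euclidean_product_topology)
  moreover have "filtermap \<Phi> V \<noteq> bot"
    using assms by (simp add: filtermap_bot_iff)
  moreover have "eventually (\<lambda>x. x \<in> PiE UNIV (\<lambda>i. {-1..1::real})) (filtermap \<Phi> V)"
    using assms(1) unfolding eventually_filtermap
    by (intro always_eventually) (auto simp: PiE_iff abs_le_iff minus_le_iff)
  ultimately obtain L where L: "inf (nhds L) (filtermap \<Phi> V) \<noteq> bot"
    unfolding compact_filter by blast
  define U where "U = inf V (filtercomap \<Phi> (nhds L))"
  have "U \<noteq> bot"
  proof
    assume "U = bot"
    then obtain P Q where PQ: "eventually P V" "eventually Q (filtercomap \<Phi> (nhds L))"
       "\<And>k. P k \<Longrightarrow> Q k \<Longrightarrow> False"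
      unfolding U_def trivial_limit_def eventually_inf by blast
    from PQ(2) obtain R where R: "eventually R (nhds L)" "\<And>k. R (\<Phi> k) \<Longrightarrow> Q k"
      unfolding eventually_filtercomap by blast
    have "eventually (\<lambda>x. \<not> R x) (filtermap \<Phi> V)"
      unfolding eventually_filtermap using PQ(1) by eventually_elim (use PQ R in blast)
    with R(1) have "eventually (\<lambda>x. False) (inf (nhds L) (filtermap \<Phi> V))"
      unfolding eventually_inf by blast
    with L show False by (simp add: trivial_limit_def)
  qed
  moreover have "((\<lambda>k. \<Phi> k i) \<longlongrightarrow> L i) U" for i
  proof -
    have "filterlim \<Phi> (nhds L) U"
      unfolding filterlim_def U_def
      by (rule order_trans[OF filtermap_mono[OF inf_le2] filtermap_filtercomap])
    then have ev: "eventually (\<lambda>k. R (\<Phi> k)) U" if "eventually R (nhds L)" for R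
      using that by (simp add: filterlim_iff)
    have op: "open ((\<lambda>x. x i) -` S :: ('i \<Rightarrow> real) set)" if "open S" for S
      using open_vimage[OF that continuous_on_product_coordinates[of i]] .
    show ?thesis
    proof (rule topological_tendstoI)
      fix S :: "real set" assume S: "open S" "L i \<in> S"
      have "eventually (\<lambda>x. x \<in> (\<lambda>x. x i) -` S) (nhds L)"
        by (rule eventually_nhds_in_open[OF op[OF S(1)]]) (use S in simp)
      from ev[OF this] show "eventually (\<lambda>k. \<Phi> k i \<in> S) U" by simp
    qed
  qed
  moreover have "U \<le> V" by (simp add: U_def)
  ultimately show ?thesis by blast
qed

text \<open>
  Convergence of averages is reduced to identifying their limit functionals, which
  have exactly the invariance that the averages have only asymptotically. If the limit failed,
  the coordinate would stay outside a neighbourhood of \<open>p\<close> along some filter, and refining that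
  filter would give a limit functional with a wrong value.
\<close>
lemma tendsto_via_cluster:
  fixes \<Phi> :: "nat \<Rightarrow> 'i \<Rightarrow> real"
  assumes bd: "\<And>k i. \<bar>\<Phi> k i\<bar> \<le> 1"
    and cl: "\<And>U L. U \<le> sequentially \<Longrightarrow> U \<noteq> bot \<Longrightarrow> (\<And>i. ((\<lambda>k. \<Phi> k i) \<longlongrightarrow> L i) U) \<Longrightarrow> L i0 = p"
  shows "(\<lambda>k. \<Phi> k i0) \<longlonglongrightarrow> p"
proof (rule ccontr)
  assume "\<not> ?thesis"
  then obtain S where S: "open S" "p \<in> S" "\<not> (\<forall>\<^sub>F k in sequentially. \<Phi> k i0 \<in> S)"
    unfolding tendsto_def by blast
  define V where "V = inf sequentially (principal {k. \<Phi> k i0 \<notin> S})"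
  have "V \<noteq> bot"
    using S(3) by (auto simp: V_def trivial_limit_def eventually_inf_principal)
  obtain U L where UL: "U \<le> V" "U \<noteq> bot" "\<And>i. ((\<lambda>k. \<Phi> k i) \<longlongrightarrow> L i) U"
    using cluster_functional[of \<Phi> V, OF bd \<open>V \<noteq> bot\<close>] by blast
  have "U \<le> sequentially" using UL(1) by (simp add: V_def)
  then have "L i0 = p" using cl UL by blast
  then have "eventually (\<lambda>k. \<Phi> k i0 \<in> S) U"
    using UL(3)[of i0] S(1,2) by (auto simp: tendsto_def)
  moreover have "eventually (\<lambda>k. \<Phi> k i0 \<notin> S) U"
  proof (rule filter_leD[OF UL(1)])
    show "eventually (\<lambda>k. \<Phi> k i0 \<notin> S) V" by (simp add: V_def eventually_inf_principal)
  qed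
  ultimately have "eventually (\<lambda>k. False) U" by eventually_elim auto
  with UL(2) show False by (simp add: trivial_limit_def)
qed

section \<open>Measure-preserving actions and invariant set functions\<close>

text \<open>
  The dynamical part of \<open>mp_system\<close>. Keeping it free of topology makes the product of a system
  with itself another instance, with the product measure as its measure.
\<close>
locale mp_action = prob_space M
  for M :: "'x measure" +
  fixes T :: "'g::ab_group_add \<Rightarrow> 'x \<Rightarrow> 'x"
  assumes T_measurable [measurable]: "T g \<in> measurable M M"
    and T_preserving: "A \<in> sets M \<Longrightarrow> emeasure M (T g -` A \<inter> space M) = emeasure M A"
    and T_zero: "x \<in> space M \<Longrightarrow> T 0 x = x"
    and T_add: "x \<in> space M \<Longrightarrow> T (g + h) x = T g (T h x)"
begin

lemma T_in_space: "x \<in> space M \<Longrightarrow> T g x \<in> space M"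
  using measurable_space[OF T_measurable] by blast

lemma T_minus_cancel: "x \<in> space M \<Longrightarrow> T (-g) (T g x) = x"
  using T_add[of x "-g" g] T_zero by simp

lemma T_image_eq:
  assumes "A \<subseteq> space M"
  shows "T g ` A = T (-g) -` A \<inter> space M"
proof (intro set_eqI iffI)
  fix x assume "x \<in> T (-g) -` A \<inter> space M"
  then show "x \<in> T g ` A"
    using T_minus_cancel[of x "-g"] by (auto intro!: image_eqI[of _ _ "T (-g) x"])
qed (use assms T_minus_cancel T_in_space in auto)

lemma T_vimage_eq:
  assumes "A \<in> sets M"
  shows "T g -` A \<inter> space M = T (-g) ` A"
  using T_image_eq[OF sets.sets_into_space[OF assms], of "-g"] by simp

lemma T_image_sets [measurable]: "A \<in> sets M \<Longrightarrow> T g ` A \<in> sets M"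
  by (simp add: T_image_eq sets.sets_into_space measurable_sets[OF T_measurable])

lemma measure_T_image: "A \<in> sets M \<Longrightarrow> measure M (T g ` A) = measure M A"
  by (simp add: T_image_eq sets.sets_into_space T_preserving measure_def)

lemma T_image_space: "T g ` space M = space M"
  using T_in_space by (auto simp: T_image_eq)

lemma T_image_image:
  assumes "A \<in> sets M"
  shows "T g ` T h ` A = T (g + h) ` A"
  using sets.sets_into_space[OF assms] by (force simp: image_image T_add)

lemma T_zero_image: "A \<in> sets M \<Longrightarrow> T 0 ` A = A"
  using sets.sets_into_space[of A M] by (force simp: T_zero subset_eq)

lemma T_image_Int:
  assumes "A \<in> sets M" "B \<in> sets M"
  shows "T g ` (A \<inter> B) = T g ` A \<inter> T g ` B"
  using assms[THEN sets.sets_into_space] by (subst (1 2 3) T_image_eq) auto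

text \<open>
  Domination by the measure turns finite into countable additivity, so \<open>lam\<close> can be
  compared with \<open>c \<mu>\<close>, for \<open>c\<close> its total mass, by a Hahn decomposition. The union \<open>Q\<close> of all translates of
  the positive set is strictly invariant; it is still positive, and its complement is negative. By
  ergodicity \<open>Q\<close> is null or conull, so \<open>lam - c \<mu>\<close> has constant sign. As it vanishes on the whole
  space, it vanishes on every set.
\<close>
lemma ergodic_invariant_set_function:
  fixes lam :: "'x set \<Rightarrow> real"
  assumes count: "countable (UNIV :: 'g set)"
    and erg: "ergodic_action M T"
    and nonneg: "\<And>A. A \<in> sets M \<Longrightarrow> 0 \<le> lam A"
    and le: "\<And>A. A \<in> sets M \<Longrightarrow> lam A \<le> measure M A"
    and add: "\<And>A B. A \<in> sets M \<Longrightarrow> B \<in> sets M \<Longrightarrow> A \<inter> B = {} \<Longrightarrow> lam (A \<union> B) = lam A + lam B"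
    and inv: "\<And>A g. A \<in> sets M \<Longrightarrow> lam (T g ` A) = lam A"
    and A: "A \<in> sets M"
  shows "lam A = lam (space M) * measure M A"
proof -
  define c where "c = lam (space M)"
  have c: "0 \<le> c" using nonneg by (simp add: c_def)
  have ca: "countably_additive (sets M) (\<lambda>A. ennreal (lam A))"
  proof (rule sets.empty_continuous_imp_countably_additive)
    have "lam {} = 0" using add[of "{}" "{}"] by simp
    then show "positive (sets M) (\<lambda>A. ennreal (lam A))" by (simp add: positive_def)
    show "additive (sets M) (\<lambda>A. ennreal (lam A))"
      by (auto simp: additive_def add nonneg ennreal_plus)
    fix B :: "nat \<Rightarrow> 'x set" assume B: "range B \<subseteq> sets M" "decseq B" "(\<Inter>i. B i) = {}"
    have "(\<lambda>i. emeasure M (B i)) \<longlonglongrightarrow> 0"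
      using Lim_emeasure_decseq[OF B(1,2)] B(3) by simp
    then show "(\<lambda>i. ennreal (lam (B i))) \<longlonglongrightarrow> 0"
      by (rule tendsto_sandwich[OF _ _ tendsto_const, rotated 2])
         (use B(1) le in \<open>auto simp: emeasure_eq_measure intro!: ennreal_leI\<close>)
  qed auto
  define N1 where "N1 = measure_of (space M) (sets M) (\<lambda>A. ennreal (lam A))"
  define N2 where "N2 = scale_measure (ennreal c) M"
  have [simp]: "sets N1 = sets M" "space N1 = space M" "sets N2 = sets M" "space N2 = space M"
    by (auto simp: N1_def N2_def space_measure_of_conv space_scale_measure)
  have N1: "emeasure N1 B = ennreal (lam B)" if "B \<in> sets M" for B
    unfolding N1_def
  proof (rule emeasure_measure_of_sigma)
    have "lam {} = 0" using add[of "{}" "{}"] by simp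
    then show "positive (sets M) (\<lambda>A. ennreal (lam A))" by (simp add: positive_def)
  qed (use ca that sets.sigma_algebra_axioms in auto)
  have N2: "emeasure N2 B = ennreal (c * measure M B)" if "B \<in> sets M" for B
    by (simp add: N2_def emeasure_eq_measure c ennreal_mult)
  have iff: "emeasure N2 B \<le> emeasure N1 B \<longleftrightarrow> c * measure M B \<le> lam B"
      "emeasure N1 B \<le> emeasure N2 B \<longleftrightarrow> lam B \<le> c * measure M B" if "B \<in> sets M" for B
    using that c nonneg by (auto simp: N1 N2)
  have "finite_measure N1" "finite_measure N2"
    by (auto intro!: finite_measureI simp: N1 N2)
  then obtain P where P: "P \<in> sets M" "\<And>B. B \<in> sets M \<Longrightarrow> B \<subseteq> P \<Longrightarrow> c * measure M B \<le> lam B"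
      "\<And>B. B \<in> sets M \<Longrightarrow> B \<inter> P = {} \<Longrightarrow> lam B \<le> c * measure M B"
    using finite_unsigned_Hahn_decomposition[of N1 N2] iff by (auto simp: Ball_def)
  \<comment> \<open>Translates of a positive set are positive, since both set functions are invariant.\<close>
  have translate: "c * measure M B \<le> lam B" if "B \<in> sets M" "B \<subseteq> T g ` P" for B g
  proof -
    have "T (-g) ` B \<subseteq> T (-g) ` T g ` P" using that(2) by blast
    also have "\<dots> = P" using T_image_image[OF P(1), of "-g" g] by (simp add: T_zero_image P)
    finally show ?thesis
      using P(2)[of "T (-g) ` B"] that(1) by (simp add: inv measure_T_image)
  qed
  define Q where "Q = (\<Union>g. T g ` P)"
  have Q: "Q \<in> sets M" unfolding Q_def
    by (rule sets.countable_UN'[OF count]) (use P in auto)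
  have below: "lam B \<le> c * measure M B" if "B \<in> sets M" "B \<inter> Q = {}" for B
  proof -
    have "P = T 0 ` P" by (simp add: T_zero_image P)
    then have "P \<subseteq> Q" unfolding Q_def by blast
    then show ?thesis using P(3) that by blast
  qed
  \<comment> \<open>A set below \<open>Q\<close> splits into countably many disjoint pieces, each below one translate.\<close>
  have above: "c * measure M B \<le> lam B" if B: "B \<in> sets M" "B \<subseteq> Q" for B
  proof -
    define C where "C n = B \<inter> T (from_nat_into UNIV n) ` P" for n
    have C: "range C \<subseteq> sets M" using B P by (auto simp: C_def)
    have D: "range (disjointed C) \<subseteq> sets M" by (rule sets.range_disjointed_sets[OF C])
    have "range (from_nat_into (UNIV::'g set)) = UNIV"
      using count by (intro range_from_nat_into) auto
    moreover have "(\<Union>n. T (from_nat_into UNIV n) ` P) = (\<Union>g\<in>range (from_nat_into (UNIV::'g set)). T g ` P)"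
      by blast
    ultimately have "(\<Union>n. T (from_nat_into UNIV n) ` P) = Q"
      by (simp only: Q_def)
    then have "B = (\<Union>n. C n)" using B(2) by (auto simp: C_def)
    then have eq: "(\<Union>n. disjointed C n) = B" by (simp add: UN_disjointed_eq)
    have "emeasure N2 B = (\<Sum>n. emeasure N2 (disjointed C n))"
      using suminf_emeasure[of "disjointed C" N2] D by (simp add: eq disjoint_family_disjointed)
    also have "\<dots> \<le> (\<Sum>n. emeasure N1 (disjointed C n))"
    proof (rule suminf_le)
      fix n
      have "disjointed C n \<subseteq> T (from_nat_into UNIV n) ` P"
        using disjointed_subset[of C n] by (auto simp: C_def)
      then show "emeasure N2 (disjointed C n) \<le> emeasure N1 (disjointed C n)"
        using translate[of "disjointed C n"] D by (subst iff) auto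
    qed auto
    also have "\<dots> = emeasure N1 B"
      using suminf_emeasure[of "disjointed C" N1] D by (simp add: eq disjoint_family_disjointed)
    finally show ?thesis using iff B by simp
  qed
  have Q_inv: "T g -` Q \<inter> space M = Q" for g
  proof -
    have "T g -` Q \<inter> space M = T (-g) ` Q" by (rule T_vimage_eq[OF Q])
    also have "\<dots> = (\<Union>h. T (-g) ` T h ` P)" by (auto simp: Q_def)
    also have "\<dots> = (\<Union>h. T (-g + h) ` P)" by (simp only: T_image_image[OF P(1)])
    also have "\<dots> = (\<Union>h\<in>range ((+) (-g)). T h ` P)" by blast
    also have "range ((+) (-g)) = UNIV" by (rule surj_plus)
    finally show ?thesis by (simp only: Q_def)
  qed
  \<comment> \<open>If \<open>A\<close> and its complement satisfy an inequality in the same direction, this forces equality for both.\<close>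
  have total: "lam A + lam (space M - A) = c * measure M A + c * measure M (space M - A)"
  proof -
    have "lam A + lam (space M - A) = c"
      using add[of A "space M - A"] A sets.sets_into_space[OF A] by (simp add: c_def Un_absorb1)
    then show ?thesis by (simp add: prob_compl[OF A] flip: distrib_left)
  qed
  moreover have decomp: "lam B = lam (B - Q) + lam (B \<inter> Q)" if "B \<in> sets M" for B
  proof -
    have "lam ((B - Q) \<union> (B \<inter> Q)) = lam (B - Q) + lam (B \<inter> Q)"
      using that Q by (intro add) auto
    then show ?thesis by (simp add: Un_Diff_Int)
  qed
  moreover have "measure M Q = 0 \<or> measure M Q = 1"
    using erg Q Q_inv unfolding ergodic_action_def by blast
  ultimately consider "measure M Q = 0" | "measure M (space M - Q) = 0"
    using prob_compl[OF Q] by auto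
  then show ?thesis
  proof cases
    case 1
    have le: "lam B \<le> c * measure M B" if B: "B \<in> sets M" for B
    proof -
      have "lam (B \<inter> Q) \<le> measure M Q"
        using le[of "B \<inter> Q"] finite_measure_mono[of "B \<inter> Q" Q] B Q by auto
      moreover have "lam B = lam (B - Q) + lam (B \<inter> Q)"
        using decomp B by blast
      moreover have "(B - Q) \<inter> Q = {}" by blast
      moreover have "c * measure M (B - Q) \<le> c * measure M B"
        using B Q c by (intro mult_left_mono finite_measure_mono) auto
      ultimately show ?thesis using below[of "B - Q", OF sets.Diff[OF B Q]] B Q 1 by auto
    qed
    show ?thesis using le[OF A] le[OF sets.compl_sets[OF A]] total by (simp add: c_def)
  next
    case 2
    have ge: "c * measure M B \<le> lam B" if B: "B \<in> sets M" for B
    proof -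
      have "measure M B = measure M (B \<inter> Q) + measure M (B - Q)"
        using B Q finite_measure_Diff'[OF B Q] by simp
      moreover have "measure M (B - Q) \<le> measure M (space M - Q)"
        using B Q sets.sets_into_space[OF B] by (intro finite_measure_mono) auto
      moreover have lam_B: "lam B = lam (B - Q) + lam (B \<inter> Q)"
        using decomp B by blast
      moreover have "0 \<le> measure M (B - Q)" by simp
      ultimately have "measure M B = measure M (B \<inter> Q)" using 2 by linarith
      with lam_B show ?thesis using above[of "B \<inter> Q"] B Q nonneg[of "B - Q"] by auto
    qed
    show ?thesis using ge[OF A] ge[OF sets.compl_sets[OF A]] total by (simp add: c_def)
  qed
qed

end

section \<open>Averages along Folner sequences\<close>

definition average :: "(nat \<Rightarrow> 'a set) \<Rightarrow> ('a \<Rightarrow> real) \<Rightarrow> nat \<Rightarrow> real" where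
  "average F \<phi> k = (\<Sum>g\<in>F k. \<phi> g) / real (card (F k))"

lemma average_mono:
  "(\<And>g. \<phi> g \<le> \<psi> g) \<Longrightarrow> average F \<phi> k \<le> average F \<psi> k"
  unfolding average_def by (intro divide_right_mono sum_mono) auto

lemma average_add: "average F (\<lambda>g. \<phi> g + \<psi> g) k = average F \<phi> k + average F \<psi> k"
  by (simp add: average_def sum.distrib add_divide_distrib)

lemma average_cmult: "average F (\<lambda>g. c * \<phi> g) k = c * average F \<phi> k"
  by (simp add: average_def flip: sum_distrib_left)

lemma average_sum: "average F (\<lambda>g. \<Sum>i\<in>I. \<phi> i g) k = (\<Sum>i\<in>I. average F (\<phi> i) k)"
  unfolding average_def sum_divide_distrib by (rule sum.swap)

lemma average_nonneg: "(\<And>g. 0 \<le> \<phi> g) \<Longrightarrow> 0 \<le> average F \<phi> k"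
  unfolding average_def by (intro divide_nonneg_nonneg sum_nonneg) auto

lemma abs_average_le:
  assumes "\<And>g. \<bar>\<phi> g\<bar> \<le> 1"
  shows "\<bar>average F \<phi> k\<bar> \<le> 1"
proof (cases "card (F k) = 0")
  case False
  have "\<bar>\<Sum>g\<in>F k. \<phi> g\<bar> \<le> real (card (F k)) * 1"
    by (rule order_trans[OF sum_abs sum_bounded_above]) (use assms in auto)
  with False show ?thesis by (simp add: average_def field_simps)
qed (simp add: average_def)

lemma folner_seqD:
  assumes "folner_seq F"
  shows "k \<ge> 1 \<Longrightarrow> finite (F k)" "k \<ge> 1 \<Longrightarrow> F k \<noteq> {}" "k \<ge> 1 \<Longrightarrow> card (F k) > 0"
  using assms by (auto simp: folner_seq_def card_gt_0_iff)

lemma average_const: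
  assumes "folner_seq F"
  shows "average F (\<lambda>_. c) \<longlonglongrightarrow> c"
proof (rule tendsto_eventually)
  show "\<forall>\<^sub>F k in sequentially. average F (\<lambda>_. c) k = c"
    using eventually_ge_at_top[of 1]
    by eventually_elim (use folner_seqD(3)[OF assms] in \<open>auto simp: average_def\<close>)
qed

text \<open>
  Translating the averaging set alters the sum only on the symmetric difference, whose relative
  size is twice the deficit from 1 in the Folner condition.
\<close>
lemma folner_average_shift:
  fixes F :: "nat \<Rightarrow> 'a::ab_group_add set"
  assumes F: "folner_seq F" and bd: "\<And>g. \<bar>\<phi> g\<bar> \<le> 1"
  shows "(\<lambda>k. average F (\<lambda>g. \<phi> (h + g)) k - average F \<phi> k) \<longlonglongrightarrow> 0"
proof (rule Lim_null_comparison)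
  define r where "r k = real (card ((+) h ` F k \<inter> F k)) / real (card (F k))" for k
  have "r \<longlonglongrightarrow> 1" using F unfolding folner_seq_def r_def by blast
  then have "(\<lambda>k. 2 * (1 - r k)) \<longlonglongrightarrow> 2 * (1 - 1)" by (intro tendsto_intros)
  then show "(\<lambda>k. 2 * (1 - r k)) \<longlonglongrightarrow> 0" by simp
  show "\<forall>\<^sub>F k in sequentially. norm (average F (\<lambda>g. \<phi> (h + g)) k - average F \<phi> k) \<le> 2 * (1 - r k)"
    using eventually_ge_at_top[of 1]
  proof eventually_elim
    case (elim k)
    let ?A = "(+) h ` F k" and ?B = "F k"
    have fin: "finite ?B" and pos: "card ?B > 0" using folner_seqD[OF F elim] by auto
    have cA: "card ?A = card ?B" by (intro card_image) auto
    have "(\<Sum>g\<in>?B. \<phi> (h + g)) = sum \<phi> ?A" by (subst sum.reindex) auto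
    also have "sum \<phi> ?A - sum \<phi> ?B = sum \<phi> (?A - ?B) - sum \<phi> (?B - ?A)"
      using sum.Int_Diff[of ?A \<phi> ?B] sum.Int_Diff[of ?B \<phi> ?A] fin by (simp add: Int_commute)
    finally have "\<bar>(\<Sum>g\<in>?B. \<phi> (h + g)) - sum \<phi> ?B\<bar> \<le> \<bar>sum \<phi> (?A - ?B)\<bar> + \<bar>sum \<phi> (?B - ?A)\<bar>"
      by linarith
    also have "\<dots> \<le> real (card (?A - ?B)) * 1 + real (card (?B - ?A)) * 1"
      by (intro add_mono order_trans[OF sum_abs sum_bounded_above] bd)
    also have "\<dots> = 2 * (real (card ?B) - real (card (?A \<inter> ?B)))"
    proof -
      have "card (?A \<inter> ?B) + card (?A - ?B) = card ?B" "card (?A \<inter> ?B) + card (?B - ?A) = card ?B"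
        using card_Int_Diff[of ?A ?B] card_Int_Diff[of ?B ?A] fin cA by (simp_all add: Int_commute)
      then have "real (card (?A \<inter> ?B)) + real (card (?A - ?B)) = card ?B" "real (card (?A \<inter> ?B)) + real (card (?B - ?A)) = card ?B"
        by linarith+
      then show ?thesis by (simp add: algebra_simps)
    qed
    finally show ?case
      using pos by (simp add: average_def r_def field_simps flip: diff_divide_distrib)
  qed
qed

section \<open>Averages of correlations for ergodic actions\<close>

context mp_action
begin

lemma measure_T_shift:
  assumes "A \<in> sets M" "B \<in> sets M"
  shows "measure M (A \<inter> T g ` B) = measure M (B \<inter> T (-g) ` A)"
proof -
  have "T (-g) ` (A \<inter> T g ` B) = B \<inter> T (-g) ` A"
    using assms by (auto simp: T_image_Int T_image_image T_zero_image)
  then show ?thesis using measure_T_image[of "A \<inter> T g ` B" "-g"] assms by simp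
qed

text \<open>
  With all other arguments fixed, the correlation is, in its \<open>j\<close>-th argument, the measure
  restricted to a fixed set. Domination, additivity and continuity in this argument are read off from
  this form.
\<close>
lemma multi_corr_slice:
  fixes A :: "'l::finite \<Rightarrow> 'x set" and g :: "'g^'l"
  assumes "A0 \<in> sets M" "\<And>i. A i \<in> sets M"
  shows "\<exists>V. V \<in> sets M \<and> (\<forall>B\<in>sets M. multi_corr M T A0 (A(j := B)) g = measure M (B \<inter> V))"
proof (intro exI conjI ballI)
  define W where "W = A0 \<inter> (\<Inter>i\<in>UNIV. if i = j then space M else T (g $ i) ` A i)"
  have W: "W \<in> sets M" unfolding W_def
    by (intro sets.Int sets.finite_INT) (use assms in auto)
  then show "T (- g $ j) ` W \<in> sets M" by simp
  fix B assume B: "B \<in> sets M"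
  have "A0 \<inter> (\<Inter>i. T (g $ i) ` (A(j := B)) i) = W \<inter> T (g $ j) ` B"
    using sets.sets_into_space[OF assms(1)] unfolding W_def
    by (auto split: if_splits)
  then show "multi_corr M T A0 (A(j := B)) g = measure M (B \<inter> T (- g $ j) ` W)"
    by (simp add: multi_corr_def measure_T_shift[OF W B])
qed

text \<open>
  Translation of the group argument by \<open>axis j h\<close> replaces the \<open>j\<close>-th set by its image under \<open>T h\<close> and
  leaves the others alone. Hence a limit functional of the averages is, in each argument, an
  invariant set function dominated by the measure, and by ergodicity each argument contributes its
  measure as a factor.
\<close>
theorem ergodic_average_multi_corr:
  fixes F :: "nat \<Rightarrow> ('g^'l::finite) set" and A :: "'l \<Rightarrow> 'x set"
  assumes count: "countable (UNIV :: 'g set)" and erg: "ergodic_action M T"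
    and F: "folner_seq F" and A0: "A0 \<in> sets M" and A: "\<And>j. A j \<in> sets M"
  shows "average F (multi_corr M T A0 A) \<longlonglongrightarrow> measure M A0 * (\<Prod>j\<in>UNIV. measure M (A j))"
proof (rule tendsto_via_cluster[of "\<lambda>k A. average F (multi_corr M T A0 A) k"])
  have bd: "\<bar>multi_corr M T A0 A g\<bar> \<le> 1" for A :: "'l \<Rightarrow> 'x set" and g
    by (simp add: multi_corr_def)
  show "\<bar>average F (multi_corr M T A0 A) k\<bar> \<le> 1" for k and A :: "'l \<Rightarrow> 'x set"
    by (rule abs_average_le) (rule bd)
  fix U and L :: "('l \<Rightarrow> 'x set) \<Rightarrow> real"
  assume U: "U \<le> sequentially" "U \<noteq> bot"
    and L: "\<And>A. (average F (multi_corr M T A0 A) \<longlongrightarrow> L A) U"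
  have L_eqI: "L B = L C" if "(\<lambda>k. average F (multi_corr M T A0 B) k - average F (multi_corr M T A0 C) k) \<longlonglongrightarrow> 0" for B C
    using tendsto_unique[OF U(2) tendsto_diff[OF L[of B] L[of C]] tendsto_mono[OF U(1) that]] by simp
  have step: "L B = L (B(j := space M)) * measure M (B j)" if B: "\<And>i. B i \<in> sets M" for B j
  proof -
    have "\<exists>V. V \<in> sets M \<and> (\<forall>C\<in>sets M. multi_corr M T A0 (B(j := C)) g = measure M (C \<inter> V))" for g
      by (rule multi_corr_slice[OF A0 B])
    then obtain V where V: "\<And>g. V g \<in> sets M"
      "\<And>g C. C \<in> sets M \<Longrightarrow> multi_corr M T A0 (B(j := C)) g = measure M (C \<inter> V g)" by metis
    have "L (B(j := B j)) = L (B(j := space M)) * measure M (B j)"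
    proof (rule ergodic_invariant_set_function[OF count erg])
      fix C assume C: "C \<in> sets M"
      show "0 \<le> L (B(j := C))"
        by (rule tendsto_lowerbound[OF L always_eventually U(2)])
           (simp add: average_nonneg multi_corr_def)
      have "multi_corr M T A0 (B(j := C)) g \<le> measure M C" for g
        using C V(1) by (simp add: V(2)[OF C] finite_measure_mono)
      then have "average F (multi_corr M T A0 (B(j := C))) k \<le> average F (\<lambda>_. measure M C) k" for k
        by (rule average_mono)
      then show "L (B(j := C)) \<le> measure M C"
        by (intro tendsto_le[OF U(2) tendsto_mono[OF U(1) average_const[OF F]] L]) auto
    next
      fix C D assume CD: "C \<in> sets M" "D \<in> sets M" "C \<inter> D = {}"
      have "multi_corr M T A0 (B(j := C \<union> D)) g = multi_corr M T A0 (B(j := C)) g + multi_corr M T A0 (B(j := D)) g" for g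
        using finite_measure_Union[of "C \<inter> V g" "D \<inter> V g"] CD V(1)
        by (auto simp: V(2) Int_Un_distrib2)
      then have "average F (multi_corr M T A0 (B(j := C \<union> D))) = (\<lambda>k. average F (multi_corr M T A0 (B(j := C))) k + average F (multi_corr M T A0 (B(j := D))) k)"
        by (simp add: fun_eq_iff flip: average_add) (simp add: average_def)
      then show "L (B(j := C \<union> D)) = L (B(j := C)) + L (B(j := D))"
        using tendsto_unique[OF U(2) L[of "B(j := C \<union> D)"]] tendsto_add[OF L[of "B(j := C)"] L[of "B(j := D)"]] by auto
    next
      fix C h assume C: "C \<in> sets M"
      have "multi_corr M T A0 (B(j := T h ` C)) g = multi_corr M T A0 (B(j := C)) (axis j h + g)" for g
      proof -
        have "T (g $ i) ` (B(j := T h ` C)) i = T ((axis j h + g) $ i) ` (B(j := C)) i" for i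
          by (auto simp: axis_def T_image_image C add.commute)
        then show ?thesis by (simp add: multi_corr_def)
      qed
      then have "average F (multi_corr M T A0 (B(j := T h ` C))) = average F (\<lambda>g. multi_corr M T A0 (B(j := C)) (axis j h + g))"
        by (simp add: average_def fun_eq_iff)
      then show "L (B(j := T h ` C)) = L (B(j := C))"
        using folner_average_shift[OF F, of "multi_corr M T A0 (B(j := C))" "axis j h"] bd
        by (intro L_eqI) auto
    qed (rule B)
    then show ?thesis by simp
  qed
  \<comment> \<open>The arguments are replaced by the whole space one at a time.\<close>
  have "L A = L (\<lambda>i. if i \<in> J then space M else A i) * (\<Prod>j\<in>J. measure M (A j))" if "finite J" for J
    using that
  proof induction
    case (insert j J)
    let ?B = "\<lambda>i. if i \<in> J then space M else A i"
    have "L ?B = L (?B(j := space M)) * measure M (A j)"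
      using step[of ?B j] insert A by auto
    also have "?B(j := space M) = (\<lambda>i. if i \<in> insert j J then space M else A i)" by (auto simp: fun_eq_iff)
    finally show ?case using insert by simp
  qed simp
  from this[of UNIV] have "L A = L (\<lambda>i. space M) * (\<Prod>j\<in>UNIV. measure M (A j))" by simp
  moreover have "L (\<lambda>i. space M) = measure M A0"
  proof -
    have "multi_corr M T A0 (\<lambda>i. space M) g = measure M A0" for g :: "'g^'l"
      using sets.sets_into_space[OF A0] by (simp add: multi_corr_def T_image_space Int_absorb2)
    then have "average F (multi_corr M T A0 (\<lambda>i. space M)) = average F (\<lambda>_. measure M A0)"
      by (simp add: average_def fun_eq_iff)
    then show ?thesis
      using tendsto_unique[OF U(2) L[of "\<lambda>i. space M"]] tendsto_mono[OF U(1) average_const[OF F, of "measure M A0"]] by simp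
  qed
  ultimately show "L A = measure M A0 * (\<Prod>j\<in>UNIV. measure M (A j))" by simp
qed

end

section \<open>Upper density and full density\<close>

lemma folner_seq_subseq:
  assumes "folner_seq F" "strict_mono r"
  shows "folner_seq (F \<circ> r)"
proof -
  have "r k \<ge> 1" if "k \<ge> 1" for k
    using seq_suble[OF assms(2), of k] that by linarith
  moreover have "(\<lambda>k. real (card ((+) g ` F (r k) \<inter> F (r k))) / real (card (F (r k)))) \<longlonglongrightarrow> 1" for g
    using LIMSEQ_subseq_LIMSEQ[OF _ assms(2), of "\<lambda>k. real (card ((+) g ` F k \<inter> F k)) / real (card (F k))" 1]
      assms(1) unfolding folner_seq_def o_def by blast
  ultimately show ?thesis using assms(1) unfolding folner_seq_def o_def by blast
qed

lemma average_subseq: "average (F \<circ> r) \<phi> k = average F \<phi> (r k)"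
  by (simp add: average_def)

lemma average_indicator:
  assumes "finite (F k)"
  shows "average F (indicat_real E) k = real (card (E \<inter> F k)) / real (card (F k))"
  using assms by (simp add: average_def sum.If_cases indicator_def Int_commute Collect_conv_if[symmetric] Int_def)

lemma average_indicator_bounds: "0 \<le> average F (indicat_real E) k" "average F (indicat_real E) k \<le> 1"
proof -
  show "0 \<le> average F (indicat_real E) k" by (rule average_nonneg) simp
  show "average F (indicat_real E) k \<le> 1"
    using abs_average_le[of "indicat_real E" F k] by (simp add: indicator_def)
qed

lemma upper_density_eq_limsup_average:
  assumes "folner_seq F"
  shows "upper_density F E = limsup (\<lambda>k. ereal (average F (indicat_real E) k))"
  unfolding upper_density_def
  by (intro Limsup_eq eventually_mono[OF eventually_ge_at_top[of 1]])
     (simp add: average_indicator folner_seqD[OF assms])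

text \<open>
  Passing to a subsequence, which is again a Folner sequence, replaces the limit superior by a
  uniform lower bound.
\<close>
lemma positive_upper_density_subseq:
  assumes F: "folner_seq F" and E: "upper_density F E > 0"
  obtains r \<delta> where "strict_mono (r :: nat \<Rightarrow> nat)" "\<delta> > 0" "\<And>k. average F (indicat_real E) (r k) \<ge> \<delta>"
proof -
  obtain d :: ereal where d: "0 < d" "d < upper_density F E" using dense[OF E] by blast
  have "d < \<infinity>" using d(2) by (metis ereal_infty_less(1) less_ereal.simps(4) not_less_iff_gr_or_eq order_less_trans)
  with d(1) obtain \<delta> where \<delta>: "d = ereal \<delta>" "\<delta> > 0" by (cases d) auto
  have freq: "\<exists>\<^sub>F k in sequentially. \<delta> < average F (indicat_real E) k"
  proof (rule ccontr)
    assume "\<not> ?thesis"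
    then have "\<forall>\<^sub>F k in sequentially. ereal (average F (indicat_real E) k) \<le> ereal \<delta>"
      by (simp add: frequently_def not_less)
    then have "upper_density F E \<le> ereal \<delta>"
      unfolding upper_density_eq_limsup_average[OF F] by (rule Limsup_bounded)
    with d \<delta> show False by simp
  qed
  then have inf: "infinite {k. \<delta> < average F (indicat_real E) k}"
    by (simp add: frequently_cofinite cofinite_eq_sequentially[symmetric])
  let ?r = "enumerate {k. \<delta> < average F (indicat_real E) k}"
  have "average F (indicat_real E) (?r k) \<ge> \<delta>" for k
    using enumerate_in_set[OF inf, of k] by simp
  with inf \<delta>(2) show thesis using that[of ?r \<delta>] by (simp add: strict_mono_enumerate)
qed

text \<open>
  Density one as a limit instead of a limit superior: this form is stable under finite
  intersections.
\<close>
definition full_density :: "'a::ab_group_add set \<Rightarrow> bool" where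
  "full_density D \<longleftrightarrow> (\<forall>F. folner_seq F \<longrightarrow> average F (indicat_real D) \<longlonglongrightarrow> 1)"

lemma full_densityD: "full_density D \<Longrightarrow> folner_seq F \<Longrightarrow> average F (indicat_real D) \<longlonglongrightarrow> 1"
  by (simp add: full_density_def)

text \<open>
  If the averages along \<open>F\<close> did not converge to 1, some subsequence of \<open>F\<close> would be a Folner sequence
  with respect to which the upper density is below 1.
\<close>
lemma uniform_density_one_iff_full_density:
  "uniform_density_one D \<longleftrightarrow> full_density D"
proof
  assume D: "full_density D"
  have "upper_density F D = 1" if F: "folner_seq F" for F
  proof -
    have "(\<lambda>k. ereal (average F (indicat_real D) k)) \<longlonglongrightarrow> ereal 1"
      using full_densityD[OF D F] by simp
    then show ?thesis
      unfolding upper_density_eq_limsup_average[OF F] by (simp add: lim_imp_Limsup one_ereal_def)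
  qed
  then show "uniform_density_one D" by (simp add: uniform_density_one_def)
next
  assume D: "uniform_density_one D"
  show "full_density D"
    unfolding full_density_def
  proof (intro allI impI, rule ccontr)
    fix F :: "nat \<Rightarrow> 'a set" assume F: "folner_seq F" and "\<not> average F (indicat_real D) \<longlonglongrightarrow> 1"
    then obtain e where e: "e > 0" "\<exists>\<^sub>F k in sequentially. \<not> dist (average F (indicat_real D) k) 1 < e"
      by (auto simp: tendsto_iff frequently_def)
    then have inf: "infinite {k. \<not> dist (average F (indicat_real D) k) 1 < e}"
      by (simp add: frequently_cofinite cofinite_eq_sequentially[symmetric])
    define r where "r = enumerate {k. \<not> dist (average F (indicat_real D) k) 1 < e}"
    have r: "strict_mono r" unfolding r_def by (rule strict_mono_enumerate[OF inf])
    have "average (F \<circ> r) (indicat_real D) k \<le> 1 - e" for k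
      using enumerate_in_set[OF inf, of k] average_indicator_bounds(2)[of F D "r k"]
      by (simp add: average_subseq r_def dist_real_def)
    then have "upper_density (F \<circ> r) D \<le> ereal (1 - e)"
      unfolding upper_density_eq_limsup_average[OF folner_seq_subseq[OF F r]]
      by (intro Limsup_bounded always_eventually) simp
    moreover have "upper_density (F \<circ> r) D = 1"
      using D folner_seq_subseq[OF F r] by (simp add: uniform_density_one_def)
    ultimately show False using e(1) by (simp add: one_ereal_def)
  qed
qed

lemma full_density_UNIV: "full_density UNIV"
  unfolding full_density_def by (simp add: indicator_def average_const)

lemma full_density_Int:
  assumes "full_density D" "full_density E"
  shows "full_density (D \<inter> E)"
  unfolding full_density_def
proof (intro allI impI)
  fix F :: "nat \<Rightarrow> 'a set" assume F: "folner_seq F"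
  have lim: "(\<lambda>k. average F (indicat_real D) k + average F (indicat_real E) k + average F (\<lambda>_. -1) k) \<longlonglongrightarrow> 1 + 1 + -1"
    by (intro tendsto_intros full_densityD[OF _ F] assms average_const[OF F])
  show "average F (indicat_real (D \<inter> E)) \<longlonglongrightarrow> 1"
  proof (rule tendsto_sandwich[OF _ _ _ tendsto_const])
    show "(\<lambda>k. average F (indicat_real D) k + average F (indicat_real E) k + average F (\<lambda>_. -1) k) \<longlonglongrightarrow> 1"
      using lim by simp
    show "\<forall>\<^sub>F k in sequentially. average F (indicat_real D) k + average F (indicat_real E) k + average F (\<lambda>_. -1) k
        \<le> average F (indicat_real (D \<inter> E)) k"
      by (intro always_eventually allI, unfold average_add[symmetric], intro average_mono)
         (auto simp: indicator_def)
  qed (simp add: average_indicator_bounds)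
qed

lemma full_density_INT:
  assumes "finite I" "\<And>i. i \<in> I \<Longrightarrow> full_density (D i)"
  shows "full_density (\<Inter>i\<in>I. D i)"
  using assms by (induction I) (auto simp: full_density_UNIV full_density_Int)

lemma full_density_mono:
  assumes "full_density D" "D \<subseteq> E"
  shows "full_density E"
  unfolding full_density_def
proof (intro allI impI)
  fix F :: "nat \<Rightarrow> 'a set" assume F: "folner_seq F"
  show "average F (indicat_real E) \<longlonglongrightarrow> 1"
  proof (rule tendsto_sandwich[OF _ _ full_densityD[OF assms(1) F] tendsto_const])
    show "\<forall>\<^sub>F k in sequentially. average F (indicat_real D) k \<le> average F (indicat_real E) k"
      by (intro always_eventually allI average_mono) (use assms(2) in \<open>auto simp: indicator_def\<close>)
  qed (simp add: average_indicator_bounds)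
qed

lemma full_density_if_variance_small:
  fixes c :: "'a::ab_group_add \<Rightarrow> real"
  assumes "\<epsilon> > 0"
    and var: "\<And>F. folner_seq F \<Longrightarrow> average F (\<lambda>g. (c g - p)\<^sup>2) \<longlonglongrightarrow> 0"
  shows "full_density {g. \<bar>c g - p\<bar> < \<epsilon>}"
  unfolding full_density_def
proof (intro allI impI)
  fix F :: "nat \<Rightarrow> 'a set" assume F: "folner_seq F"
  let ?D = "{g. \<bar>c g - p\<bar> < \<epsilon>}"
  have chebyshev: "1 - (c g - p)\<^sup>2 / \<epsilon>\<^sup>2 \<le> indicat_real ?D g" for g
  proof (cases "g \<in> ?D")
    case False
    then have "\<epsilon>\<^sup>2 \<le> (c g - p)\<^sup>2" using \<open>\<epsilon> > 0\<close> by (intro abs_le_square_iff[THEN iffD1]) auto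
    with False \<open>\<epsilon> > 0\<close> show ?thesis by (simp add: field_simps)
  qed simp
  have "(\<lambda>k. average F (\<lambda>_. 1) k + (- 1 / \<epsilon>\<^sup>2) * average F (\<lambda>g. (c g - p)\<^sup>2) k) \<longlonglongrightarrow> 1 + (- 1 / \<epsilon>\<^sup>2) * 0"
    by (intro tendsto_intros var average_const F)
  then have lim: "(\<lambda>k. average F (\<lambda>_. 1) k + (- 1 / \<epsilon>\<^sup>2) * average F (\<lambda>g. (c g - p)\<^sup>2) k) \<longlonglongrightarrow> 1"
    by simp
  show "average F (indicat_real ?D) \<longlonglongrightarrow> 1"
  proof (rule tendsto_sandwich[OF _ _ lim tendsto_const])
    show "\<forall>\<^sub>F k in sequentially. average F (\<lambda>_. 1) k + (- 1 / \<epsilon>\<^sup>2) * average F (\<lambda>g. (c g - p)\<^sup>2) k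
        \<le> average F (indicat_real ?D) k"
      by (intro always_eventually allI, unfold average_cmult[symmetric] average_add[symmetric], intro average_mono)
         (use chebyshev in simp)
  qed (simp add: average_indicator_bounds)
qed

section \<open>Weak mixing and the density of return sets\<close>

context mp_action
begin

lemma mp_action_product: "mp_action (M \<Otimes>\<^sub>M M) (\<lambda>g. map_prod (T g) (T g))"
proof -
  interpret P: pair_prob_space M M ..
  have meas: "map_prod (T g) (T g) \<in> measurable (M \<Otimes>\<^sub>M M) (M \<Otimes>\<^sub>M M)" for g
    unfolding map_prod_def by measurable
  have distr: "distr M M (T g) = M" for g
    by (rule measure_eqI) (simp_all add: emeasure_distr T_preserving)
  have distr2: "distr (M \<Otimes>\<^sub>M M) (M \<Otimes>\<^sub>M M) (map_prod (T g) (T g)) = M \<Otimes>\<^sub>M M" for g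
    using pair_measure_distr[of "T g" M M "T g" M M] by (simp add: distr map_prod_def sigma_finite_measure_axioms)
  show ?thesis
  proof
    fix A g assume A: "A \<in> sets (M \<Otimes>\<^sub>M M)"
    show "emeasure (M \<Otimes>\<^sub>M M) (map_prod (T g) (T g) -` A \<inter> space (M \<Otimes>\<^sub>M M)) = emeasure (M \<Otimes>\<^sub>M M) A"
      using emeasure_distr[OF meas[of g] A] by (simp add: distr2)
  qed (auto simp: meas space_pair_measure T_zero T_add)
qed

lemma measure_product_Times:
  assumes "A \<in> sets M" "B \<in> sets M"
  shows "measure (M \<Otimes>\<^sub>M M) (A \<times> B) = measure M A * measure M B"
  using assms by (simp add: measure_def emeasure_pair_measure_Times enn2real_mult)

text \<open>
  An invariant set \<open>A\<close> gives the invariant cylinder \<open>A \<times> X\<close> of the same measure.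
\<close>
lemma weakly_mixing_imp_ergodic:
  assumes "weakly_mixing M T"
  shows "ergodic_action M T"
  unfolding ergodic_action_def
proof (intro ballI impI)
  fix A assume A: "A \<in> sets M" "\<forall>g. T g -` A \<inter> space M = A"
  have "map_prod (T g) (T g) -` (A \<times> space M) \<inter> space (M \<Otimes>\<^sub>M M) = A \<times> space M" for g
    using A(2)[rule_format, of g] by (auto simp: space_pair_measure T_in_space)
  then have "measure (M \<Otimes>\<^sub>M M) (A \<times> space M) = 0 \<or> measure (M \<Otimes>\<^sub>M M) (A \<times> space M) = 1"
    using assms A(1) unfolding weakly_mixing_def ergodic_action_def by (metis pair_measureI sets.top)
  then show "measure M A = 0 \<or> measure M A = 1"
    using A(1) by (simp add: measure_product_Times prob_space)
qed

text \<open>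
  Through this identity ergodicity of the product system controls second moments of
  correlations.
\<close>
lemma multi_corr_product:
  assumes "A0 \<in> sets M" "\<And>j. A j \<in> sets M"
  shows "multi_corr (M \<Otimes>\<^sub>M M) (\<lambda>g. map_prod (T g) (T g)) (A0 \<times> A0) (\<lambda>j. A j \<times> A j) g = (multi_corr M T A0 A g)\<^sup>2"
proof -
  let ?W = "A0 \<inter> (\<Inter>j\<in>UNIV. T (g $ j) ` A j)"
  have "?W \<in> sets M" using assms by (intro sets.Int sets.finite_INT) auto
  moreover have "(A0 \<times> A0) \<inter> (\<Inter>j\<in>UNIV. map_prod (T (g $ j)) (T (g $ j)) ` (A j \<times> A j)) = ?W \<times> ?W"
    unfolding map_prod_surj_on[OF refl refl] by blast
  ultimately show ?thesis
    by (simp add: multi_corr_def measure_product_Times power2_eq_square)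
qed

text \<open>
  The averages of the correlation \<open>c\<close> tend to \<open>p\<close> and those of \<open>c\<^sup>2\<close> to \<open>p\<^sup>2\<close>, so the variance about \<open>p\<close> tends
  to \<open>p\<^sup>2 - 2 p p + p\<^sup>2 = 0\<close>.
\<close>
theorem weakly_mixing_imp_R_set_full_density:
  fixes A :: "'l::finite \<Rightarrow> 'x set"
  assumes count: "countable (UNIV :: 'g set)" and wm: "weakly_mixing M T"
    and A0: "A0 \<in> sets M" and A: "\<And>j. A j \<in> sets M" and "\<epsilon> > 0"
  shows "full_density (R_set M T \<epsilon> A0 A)"
  unfolding R_set_def
proof (rule full_density_if_variance_small[OF \<open>\<epsilon> > 0\<close>])
  interpret P: mp_action "M \<Otimes>\<^sub>M M" "\<lambda>g. map_prod (T g) (T g)" by (rule mp_action_product)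
  fix F :: "nat \<Rightarrow> ('g^'l) set" assume F: "folner_seq F"
  let ?c = "multi_corr M T A0 A" and ?p = "measure M A0 * (\<Prod>j\<in>UNIV. measure M (A j))"
  have 1: "average F ?c \<longlonglongrightarrow> ?p"
    by (rule ergodic_average_multi_corr[OF count weakly_mixing_imp_ergodic[OF wm] F A0 A])
  have "average F (multi_corr (M \<Otimes>\<^sub>M M) (\<lambda>g. map_prod (T g) (T g)) (A0 \<times> A0) (\<lambda>j. A j \<times> A j))
      \<longlonglongrightarrow> measure (M \<Otimes>\<^sub>M M) (A0 \<times> A0) * (\<Prod>j\<in>UNIV. measure (M \<Otimes>\<^sub>M M) (A j \<times> A j))"
    by (rule P.ergodic_average_multi_corr[OF count _ F]) (use wm A0 A in \<open>auto simp: weakly_mixing_def\<close>)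
  moreover have "multi_corr (M \<Otimes>\<^sub>M M) (\<lambda>g. map_prod (T g) (T g)) (A0 \<times> A0) (\<lambda>j. A j \<times> A j) = (\<lambda>g. (?c g)\<^sup>2)"
    by (intro ext multi_corr_product A0 A)
  ultimately have 2: "average F (\<lambda>g. (?c g)\<^sup>2) \<longlonglongrightarrow> ?p\<^sup>2"
    using A0 A by (simp add: measure_product_Times power2_eq_square prod.distrib algebra_simps)
  have "(\<lambda>k. average F (\<lambda>g. (?c g)\<^sup>2) k + ((- 2 * ?p) * average F ?c k + average F (\<lambda>_. ?p\<^sup>2) k))
      \<longlonglongrightarrow> ?p\<^sup>2 + ((- 2 * ?p) * ?p + ?p\<^sup>2)"
    by (intro tendsto_intros 1 2 average_const F)
  then show "average F (\<lambda>g. (?c g - ?p)\<^sup>2) \<longlonglongrightarrow> 0"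
    unfolding average_cmult[symmetric] average_add[symmetric]
    by (simp add: power2_eq_square algebra_simps)
qed

end

section \<open>Existence of Folner sequences\<close>

text \<open>
  The sums of elements of \<open>S\<close> with multiplicities at most \<open>r\<close>; the inner sum is the multiple \<open>a s \<cdot> s\<close>.
\<close>
definition sum_box :: "'a::ab_group_add set \<Rightarrow> nat \<Rightarrow> 'a set" where
  "sum_box S r = (\<lambda>a. \<Sum>s\<in>S. \<Sum>i<a s. s) ` (S \<rightarrow>\<^sub>E {..r})"

lemma sum_box_translate:
  assumes "finite S" "s \<in> S"
  shows "(+) s ` sum_box S r \<subseteq> sum_box S (Suc r)"
proof (clarsimp simp: sum_box_def)
  fix a assume a: "a \<in> S \<rightarrow>\<^sub>E {..r}"
  have "s + (\<Sum>s\<in>S. \<Sum>i<a s. s) = (\<Sum>t\<in>S. \<Sum>i<(a(s := Suc (a s))) t. t)"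
    using assms by (simp add: sum.remove[of S s] algebra_simps)
  moreover have "a(s := Suc (a s)) \<in> S \<rightarrow>\<^sub>E {..Suc r}"
    using a assms by (auto simp: PiE_iff extensional_def le_SucI)
  ultimately show "s + (\<Sum>s\<in>S. \<Sum>i<a s. s) \<in> (\<lambda>a. \<Sum>s\<in>S. \<Sum>i<a s. s) ` (S \<rightarrow>\<^sub>E {..Suc r})"
    by blast
qed

lemma sum_box_mono: "sum_box S r \<subseteq> sum_box S (Suc r)"
  unfolding sum_box_def by (intro image_mono PiE_mono) auto

lemma sum_box_finite: "finite S \<Longrightarrow> finite (sum_box S r)"
  unfolding sum_box_def by (intro finite_imageI finite_PiE) auto

lemma sum_box_nonempty: "sum_box S r \<noteq> {}"
  by (auto simp: sum_box_def PiE_eq_empty_iff)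

lemma card_sum_box_le:
  assumes "finite S"
  shows "card (sum_box S r) \<le> (r + 1) ^ card S"
proof -
  have "card (sum_box S r) \<le> card (S \<rightarrow>\<^sub>E {..r})"
    unfolding sum_box_def by (intro card_image_le finite_PiE assms) auto
  also have "\<dots> = (r + 1) ^ card S" using assms by (simp add: card_PiE)
  finally show ?thesis .
qed

lemma exponential_beats_polynomial:
  assumes "(c::real) > 1"
  shows "\<exists>r. real ((r + 1) ^ n) < c ^ r"
proof -
  \<comment> \<open>Substituting \<open>x = (r + 1) ln c\<close> turns \<open>x\<^sup>n / exp x\<close> into the wanted quotient, up to the constant factor \<open>ln c\<^sup>n / c\<close>.\<close>
  let ?x = "\<lambda>r. real (r + 1) * ln c"
  have ln: "ln c > 0" using assms by simp
  have "filterlim ?x at_top sequentially"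
    using filterlim_Suc by (intro filterlim_at_top_mult_tendsto_pos[OF tendsto_const ln] filterlim_compose[OF filterlim_real_sequentially])
      (simp add: filterlim_Suc)
  then have "(\<lambda>r. ?x r ^ n / exp (?x r)) \<longlonglongrightarrow> 0"
    by (rule filterlim_compose[OF tendsto_power_div_exp_0])
  moreover have "0 < ln c ^ n / c" using ln assms by simp
  ultimately have "\<forall>\<^sub>F r in sequentially. ?x r ^ n / exp (?x r) < ln c ^ n / c"
    by (rule order_tendstoD)
  then obtain r where "?x r ^ n / exp (?x r) < ln c ^ n / c"
    using eventually_happens'[OF sequentially_bot] by blast
  moreover have "exp (?x r) = c ^ (r + 1)"
    using assms by (subst exp_of_nat_mult) simp
  ultimately have "real (r + 1) ^ n * ln c ^ n < ln c ^ n / c * c ^ (r + 1)"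
    using assms by (simp only: power_mult_distrib) (simp add: pos_divide_less_eq)
  also have "\<dots> = c ^ r * ln c ^ n" using assms by simp
  finally have "real ((r + 1) ^ n) < c ^ r" using ln by simp
  then show ?thesis by blast
qed

text \<open>
  The cardinality of \<open>sum_box S r\<close> is polynomially bounded in \<open>r\<close>, so it cannot grow by the factor \<open>1 + \<epsilon>\<close>
  at every step. Where it does not, the box is almost invariant, because the box and its
  translates by elements of \<open>S\<close> all lie in the next box.
\<close>
lemma almost_invariant_finite_set:
  fixes S :: "'a::ab_group_add set"
  assumes S: "finite S" and "\<epsilon> > 0"
  obtains F where "finite F" "F \<noteq> {}" "\<And>s. s \<in> S \<Longrightarrow> real (card ((+) s ` F \<inter> F)) \<ge> (1 - \<epsilon>) * real (card F)"
proof -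
  have "\<exists>r. real (card (sum_box S (Suc r))) \<le> (1 + \<epsilon>) * real (card (sum_box S r))"
  proof (rule ccontr)
    assume "\<not> ?thesis"
    then have grow: "(1 + \<epsilon>) * real (card (sum_box S r)) \<le> real (card (sum_box S (Suc r)))" for r
      by (simp add: not_le less_imp_le)
    have "(1 + \<epsilon>) ^ r \<le> real (card (sum_box S r))" for r
    proof (induction r)
      case 0
      show ?case using sum_box_finite[OF S, of 0] sum_box_nonempty[of S 0] by (simp add: Suc_le_eq card_gt_0_iff)
    next
      case (Suc r)
      have "(1 + \<epsilon>) ^ Suc r \<le> (1 + \<epsilon>) * real (card (sum_box S r))"
        using Suc \<open>\<epsilon> > 0\<close> by (simp add: mult_left_mono)
      with grow[of r] show ?case by linarith
    qed
    moreover have "real (card (sum_box S r)) \<le> real ((r + 1) ^ card S)" for r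
      using card_sum_box_le[OF S] by (simp only: of_nat_le_iff)
    moreover obtain r where "real ((r + 1) ^ card S) < (1 + \<epsilon>) ^ r"
      using exponential_beats_polynomial[of "1 + \<epsilon>"] \<open>\<epsilon> > 0\<close> by auto
    ultimately show False by (meson not_le order_trans)
  qed
  then obtain r where r: "real (card (sum_box S (Suc r))) \<le> (1 + \<epsilon>) * real (card (sum_box S r))" by blast
  show thesis
  proof (rule that[OF sum_box_finite[OF S] sum_box_nonempty])
    fix s assume s: "s \<in> S"
    let ?B = "sum_box S r"
    have fin: "finite ?B" by (rule sum_box_finite[OF S])
    have "card ((+) s ` ?B \<union> ?B) \<le> card (sum_box S (Suc r))"
      using sum_box_translate[OF S s] sum_box_mono[of S r] by (intro card_mono sum_box_finite S) auto
    moreover have "card ((+) s ` ?B) + card ?B = card ((+) s ` ?B \<union> ?B) + card ((+) s ` ?B \<inter> ?B)"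
      using fin by (intro card_Un_Int) auto
    moreover have "card ((+) s ` ?B) = card ?B" by (intro card_image) auto
    ultimately have "2 * real (card ?B) \<le> real (card (sum_box S (Suc r))) + real (card ((+) s ` ?B \<inter> ?B))"
      by linarith
    with r show "(1 - \<epsilon>) * real (card ?B) \<le> real (card ((+) s ` ?B \<inter> ?B))"
      by (simp add: algebra_simps)
  qed
qed

theorem folner_seq_exists:
  assumes "countable (UNIV :: 'a::ab_group_add set)"
  obtains F :: "nat \<Rightarrow> 'a::ab_group_add set" where "folner_seq F"
proof -
  define e where "e = from_nat_into (UNIV :: 'a set)"
  have e: "range e = UNIV" unfolding e_def using assms by (intro range_from_nat_into) auto
  have "\<exists>F. finite F \<and> F \<noteq> {} \<and> (\<forall>i<n. real (card ((+) (e i) ` F \<inter> F)) \<ge> (1 - 1 / real (Suc n)) * real (card F))" for n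
    by (rule almost_invariant_finite_set[of "e ` {..<n}" "1 / real (Suc n)"]) auto
  then obtain F where F: "\<And>n. finite (F n)" "\<And>n. F n \<noteq> {}"
      "\<And>n i. i < n \<Longrightarrow> real (card ((+) (e i) ` F n \<inter> F n)) \<ge> (1 - 1 / real (Suc n)) * real (card (F n))"
    by metis
  have "(\<lambda>k. real (card ((+) g ` F k \<inter> F k)) / real (card (F k))) \<longlonglongrightarrow> 1" for g
  proof -
    obtain i where i: "g = e i" using e by (metis UNIV_I imageE)
    have pos: "card (F k) > 0" for k using F(1,2) by (simp add: card_gt_0_iff)
    have lim: "(\<lambda>k. 1 - 1 / real (Suc k)) \<longlonglongrightarrow> 1"
      using tendsto_diff[OF tendsto_const[of 1] LIMSEQ_inverse_real_of_nat] by (simp add: inverse_eq_divide)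
    show ?thesis
    proof (rule tendsto_sandwich[OF _ _ lim tendsto_const])
      show "\<forall>\<^sub>F k in sequentially. 1 - 1 / real (Suc k) \<le> real (card ((+) g ` F k \<inter> F k)) / real (card (F k))"
        using eventually_gt_at_top[of i]
        by eventually_elim (use F(3) pos i in \<open>simp add: pos_le_divide_eq\<close>)
      have "card ((+) g ` F k \<inter> F k) \<le> card (F k)" for k
        using F(1) by (intro card_mono) auto
      then show "\<forall>\<^sub>F k in sequentially. real (card ((+) g ` F k \<inter> F k)) / real (card (F k)) \<le> 1"
        using pos by (intro always_eventually) simp
    qed
  qed
  then have "folner_seq F" using F(1,2) by (simp add: folner_seq_def)
  then show thesis by (rule that)
qed

section \<open>Convergence of correlations from a generator\<close>

text \<open>
  The sets with the asserted convergence form a Dynkin system. For a countable disjoint union the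
  \<open>i\<close>-th term is at most the measure of \<open>A i\<close> uniformly in \<open>k\<close>, so that Tannery's theorem exchanges the limit
  with the sum.
\<close>
lemma (in finite_measure) measure_Int_tendsto_from_generator:
  assumes G: "Int_stable G" "G \<subseteq> Pow (space M)" "sets M = sigma_sets (space M) G"
    and V: "\<And>k. V k \<in> sets M"
    and lim_space: "(\<lambda>k. measure M (V k)) \<longlonglongrightarrow> c * measure M (space M)"
    and lim_G: "\<And>A. A \<in> G \<Longrightarrow> (\<lambda>k. measure M (A \<inter> V k)) \<longlonglongrightarrow> c * measure M A"
    and "A \<in> sets M"
  shows "(\<lambda>k. measure M (A \<inter> V k)) \<longlonglongrightarrow> c * measure M A"
proof -
  have "A \<in> sigma_sets (space M) G" using assms by simp
  from G(1,2) this show ?thesis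
  proof (induction rule: sigma_sets_induct_disjoint)
    case (compl A)
    then have A: "A \<in> sets M" by (simp add: G(3))
    have "measure M ((space M - A) \<inter> V k) = measure M (V k) - measure M (A \<inter> V k)" for k
    proof -
      have "(space M - A) \<inter> V k = V k - A" using sets.sets_into_space[OF V[of k]] by blast
      then show ?thesis using finite_measure_Diff'[OF V[of k] A] by (simp add: Int_commute)
    qed
    moreover have "(\<lambda>k. measure M (V k) - measure M (A \<inter> V k)) \<longlonglongrightarrow> c * measure M (space M) - c * measure M A"
      by (intro tendsto_diff lim_space compl)
    ultimately show ?case
      using finite_measure_compl[OF A] by (simp add: right_diff_distrib)
  next
    case (union A)
    then have A: "\<And>i. A i \<in> sets M" by (auto simp: G(3))
    have disj: "disjoint_family (\<lambda>i. A i \<inter> V k)" for k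
      using union(1) by (auto simp: disjoint_family_on_def)
    have sums: "(\<lambda>i. measure M (A i)) sums measure M (\<Union>i. A i)"
      using finite_measure_UNION[of A] A union(1) by auto
    have sumsV: "(\<lambda>i. measure M (A i \<inter> V k)) sums measure M ((\<Union>i. A i) \<inter> V k)" for k
      using finite_measure_UNION[of "\<lambda>i. A i \<inter> V k", OF _ disj] A V by auto
    have "(\<lambda>k. \<Sum>i. measure M (A i \<inter> V k)) \<longlonglongrightarrow> (\<Sum>i. c * measure M (A i))"
    proof (rule tannerys_theorem[THEN conjunct2, THEN conjunct2])
      show "\<forall>\<^sub>F (i, k) in sequentially \<times>\<^sub>F sequentially. norm (measure M (A i \<inter> V k)) \<le> measure M (A i)"
        using A V by (intro always_eventually) (auto intro!: finite_measure_mono)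
      show "summable (\<lambda>i. measure M (A i))" using sums by (rule sums_summable)
    qed (use union in auto)
    then show ?case
      using sums_unique[OF sumsV] sums_unique[OF sums_mult[OF sums, of c]] by simp
  qed (simp_all add: lim_G)
qed

text \<open>
  The balls of radius \<open>1/(n+1)\<close> around the points of finite nets form a countable base of the compact
  space; their finite intersections are in addition stable under intersection.
\<close>
lemma (in mp_system) countable_generator:
  obtains G where "countable G" "Int_stable G" "space M \<in> G" "G \<subseteq> Pow (space M)" "sets M = sigma_sets (space M) G"
proof -
  let ?K = "space M"
  have "\<exists>D. finite D \<and> ?K \<subseteq> (\<Union>x\<in>D. ball x (1 / real (Suc n)))" for n
    by (rule compact_eq_totally_bounded[THEN iffD1, OF compact_space, THEN conjunct2, rule_format]) simp
  then obtain D where D: "\<And>n. finite (D n)" "\<And>n. ?K \<subseteq> (\<Union>x\<in>D n. ball x (1 / real (Suc n)))" by metis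
  define B where "B = (\<lambda>(n, x). ?K \<inter> ball x (1 / real (Suc n))) ` (SIGMA n:UNIV. D n)"
  have B: "countable B" unfolding B_def
    by (intro countable_image countable_SIGMA) (simp_all add: D(1) countable_finite)
  have union: "?K \<inter> U = \<Union>{b \<in> B. b \<subseteq> U}" if U: "open U" for U
  proof (intro equalityI subsetI)
    fix x assume x: "x \<in> ?K \<inter> U"
    obtain e where e: "e > 0" "ball x e \<subseteq> U" using openE[OF U, of x] x by blast
    have "e / 2 > 0" using e(1) by simp
    then obtain n where n: "1 / real (Suc n) < e / 2" by (rule nat_approx_posE)
    obtain y where y: "y \<in> D n" "dist y x < 1 / real (Suc n)" using D(2)[of n] x by force
    have "ball y (1 / real (Suc n)) \<subseteq> ball x e"
    proof
      fix z assume "z \<in> ball y (1 / real (Suc n))"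
      then have "dist x z < 1 / real (Suc n) + 1 / real (Suc n)"
        using y(2) dist_triangle[of x z y] by (simp add: dist_commute)
      with n show "z \<in> ball x e" by simp
    qed
    then have "?K \<inter> ball y (1 / real (Suc n)) \<subseteq> U" using e by blast
    moreover have "?K \<inter> ball y (1 / real (Suc n)) \<in> B" using y(1) by (auto simp: B_def)
    moreover have "x \<in> ?K \<inter> ball y (1 / real (Suc n))" using x y(2) by simp
    ultimately show "x \<in> \<Union>{b \<in> B. b \<subseteq> U}" by blast
  qed (auto simp: B_def)
  define G where "G = (\<lambda>C. ?K \<inter> \<Inter>C) ` {C. finite C \<and> C \<subseteq> B}"
  have setsM: "sets M = sigma_sets ?K ((\<inter>) ?K ` {S. open S})"
  proof -
    have borel: "sets (borel :: 'x measure) = sigma_sets UNIV {S. open S}" by (simp add: borel_def)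
    have "?K \<in> sets borel" by (rule borel_compact[OF compact_space])
    then have "?K \<in> sigma_sets UNIV {S. open S}" by (simp only: borel)
    then have "(\<inter>) ?K ` sigma_sets UNIV {S. open S} = sigma_sets ?K ((\<inter>) ?K ` {S. open S})"
      by (rule sigma_sets_Int) simp
    then show ?thesis by (simp only: sets_borel sets_restrict_space borel)
  qed
  have BG: "b \<in> G" if "b \<in> B" for b
    unfolding G_def by (rule image_eqI[of _ _ "{b}"]) (use that in \<open>auto simp: B_def\<close>)
  show thesis
  proof
    show "countable G" unfolding G_def
      by (intro countable_image countable_Collect_finite_subset B)
    show "Int_stable G"
    proof (rule Int_stableI)
      fix a b assume "a \<in> G" "b \<in> G"
      then obtain C C' where "finite C" "C \<subseteq> B" "a = ?K \<inter> \<Inter>C" "finite C'" "C' \<subseteq> B" "b = ?K \<inter> \<Inter>C'"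
        unfolding G_def by blast
      then show "a \<inter> b \<in> G"
        unfolding G_def by (intro image_eqI[of _ _ "C \<union> C'"]) auto
    qed
    show "?K \<in> G" unfolding G_def by (rule image_eqI[of _ _ "{}"]) auto
    show GP: "G \<subseteq> Pow ?K" by (auto simp: G_def)
    have gen: "?K \<inter> U \<in> sigma_sets ?K G" if "open U" for U
    proof -
      interpret S: sigma_algebra ?K "sigma_sets ?K G" by (rule sigma_algebra_sigma_sets[OF GP])
      show ?thesis unfolding union[OF that]
        by (rule S.countable_Union) (use B BG in \<open>auto intro: countable_subset\<close>)
    qed
    have "G \<subseteq> sets M"
    proof
      fix b assume "b \<in> G"
      then obtain C where C: "finite C" "C \<subseteq> B" "b = ?K \<inter> \<Inter>C" unfolding G_def by blast
      have "B \<subseteq> sets M" unfolding setsM B_def by (auto intro!: sigma_sets.Basic)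
      then have "C \<subseteq> sets M" using C(2) by blast
      with C(1) have "?K \<inter> \<Inter>C \<in> sets M"
      proof (induction C)
        case (insert c C)
        then have "c \<inter> (?K \<inter> \<Inter>C) \<in> sets M" by auto
        then show ?case by (simp add: Int_left_commute)
      qed simp
      then show "b \<in> sets M" by (simp add: C)
    qed
    then have "sigma_sets ?K G \<subseteq> sets M" by (rule sets.sigma_sets_subset)
    moreover have "sets M \<subseteq> sigma_sets ?K G"
      unfolding setsM by (rule sigma_sets_mono) (use gen in auto)
    ultimately show "sets M = sigma_sets ?K G" by blast
  qed
qed

lemma (in mp_system) is_mp_action: "mp_action M T"
  by standard (auto intro: T_measurable T_preserving T_zero T_add)

context mp_action
begin

text \<open>
  The generator is enlarged to all measurable sets in one argument after the other, each time by
  \<open>measure_Int_tendsto_from_generator\<close> applied to the slice in that argument.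
\<close>
lemma multi_corr_tendsto_from_generator:
  fixes g :: "nat \<Rightarrow> 'g^'l::finite" and A :: "'l \<Rightarrow> 'x set"
  assumes G: "Int_stable G" "space M \<in> G" "G \<subseteq> Pow (space M)" "sets M = sigma_sets (space M) G"
    and lim: "\<And>A0 (A :: 'l \<Rightarrow> 'x set). A0 \<in> G \<Longrightarrow> (\<And>j. A j \<in> G) \<Longrightarrow>
      (\<lambda>k. multi_corr M T A0 A (g k)) \<longlonglongrightarrow> measure M A0 * (\<Prod>j\<in>UNIV. measure M (A j))"
    and A0: "A0 \<in> sets M" and A: "\<And>j. A j \<in> sets M"
  shows "(\<lambda>k. multi_corr M T A0 A (g k)) \<longlonglongrightarrow> measure M A0 * (\<Prod>j\<in>UNIV. measure M (A j))"
proof -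
  have GM: "B \<in> sets M" if "B \<in> G" for B using that by (simp add: G(4) sigma_sets.Basic)
  \<comment> \<open>First the argument \<open>A0\<close>, then by induction those indexed by \<open>J\<close>.\<close>
  have first: "(\<lambda>k. multi_corr M T A0 A (g k)) \<longlonglongrightarrow> measure M A0 * (\<Prod>j\<in>UNIV. measure M (A j))"
    if A: "\<And>j. A j \<in> G" for A
  proof -
    define V where "V k = (\<Inter>j\<in>UNIV. T (g k $ j) ` A j)" for k
    have V: "V k \<in> sets M" for k unfolding V_def by (intro sets.finite_INT) (use A GM in auto)
    have eq: "multi_corr M T B A (g k) = measure M (B \<inter> V k)" for B k
      by (simp add: multi_corr_def V_def)
    let ?c = "\<Prod>j\<in>UNIV. measure M (A j)"
    have "(\<lambda>k. measure M (A0 \<inter> V k)) \<longlonglongrightarrow> ?c * measure M A0"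
    proof (rule measure_Int_tendsto_from_generator[OF G(1,3,4) V _ _ A0])
      have lim': "(\<lambda>k. measure M (B \<inter> V k)) \<longlonglongrightarrow> ?c * measure M B" if "B \<in> G" for B
        using lim[of B A, OF that A] by (simp add: eq mult.commute)
      then show "(\<lambda>k. measure M (B \<inter> V k)) \<longlonglongrightarrow> ?c * measure M B" if "B \<in> G" for B
        using that .
      show "(\<lambda>k. measure M (V k)) \<longlonglongrightarrow> ?c * measure M (space M)"
        using lim'[OF G(2)] sets.sets_into_space[OF V] by (simp add: Int_absorb1)
    qed
    then show ?thesis by (simp add: eq mult.commute)
  qed
  have "(\<lambda>k. multi_corr M T A0 A (g k)) \<longlonglongrightarrow> measure M A0 * (\<Prod>j\<in>UNIV. measure M (A j))"
    if "finite J" "\<And>j. j \<in> J \<Longrightarrow> A j \<in> sets M" "\<And>j. j \<notin> J \<Longrightarrow> A j \<in> G" for J A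
    using that
  proof (induction J arbitrary: A)
    case empty
    then show ?case using first by simp
  next
    case (insert j J)
    have A: "A i \<in> sets M" for i using insert.prems GM by blast
    define c where "c = measure M A0 * (\<Prod>i\<in>UNIV - {j}. measure M (A i))"
    have prod: "measure M A0 * (\<Prod>i\<in>UNIV. measure M ((A(j := B)) i)) = c * measure M B" for B
      by (subst prod.remove[of UNIV j]) (auto simp: c_def intro!: prod.cong)
    have "\<exists>V. V \<in> sets M \<and> (\<forall>B\<in>sets M. multi_corr M T A0 (A(j := B)) (g k) = measure M (B \<inter> V))" for k
      by (rule multi_corr_slice[OF A0 A])
    then obtain V where V: "\<And>k. V k \<in> sets M"
      "\<And>k B. B \<in> sets M \<Longrightarrow> multi_corr M T A0 (A(j := B)) (g k) = measure M (B \<inter> V k)" by metis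
    have lim': "(\<lambda>k. measure M (B \<inter> V k)) \<longlonglongrightarrow> c * measure M B" if "B \<in> G" for B
    proof -
      have "(\<lambda>k. multi_corr M T A0 (A(j := B)) (g k)) \<longlonglongrightarrow> measure M A0 * (\<Prod>i\<in>UNIV. measure M ((A(j := B)) i))"
        by (rule insert.IH) (use that A insert.prems insert.hyps in auto)
      then show ?thesis using V(2)[OF GM[OF that]] by (simp only: prod)
    qed
    have "(\<lambda>k. measure M (A j \<inter> V k)) \<longlonglongrightarrow> c * measure M (A j)"
    proof (rule measure_Int_tendsto_from_generator[OF G(1,3,4) V(1) _ lim' A])
      show "(\<lambda>k. measure M (V k)) \<longlonglongrightarrow> c * measure M (space M)"
        using lim'[OF G(2)] sets.sets_into_space[OF V(1)] by (simp add: Int_absorb1)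
    qed
    then show ?case using V(2)[OF A, of j] prod[of "A j"] by simp
  qed
  from this[of UNIV A] show ?thesis using A by simp
qed

section \<open>Mixing sequences imply weak mixing\<close>

text \<open>
  Convergence holds for rectangles of the product by multiplication, and extends to all measurable
  sets first in one argument, then, after moving the transformation to the other side, in the other.
  For an invariant set \<open>W\<close> the correlation of \<open>W\<close> with its image is constantly the measure of \<open>W\<close>, and its
  limit is the square of that measure.
\<close>
theorem mixing_sequence_imp_weakly_mixing:
  assumes lim: "\<And>A B. A \<in> sets M \<Longrightarrow> B \<in> sets M \<Longrightarrow>
    (\<lambda>k. measure M (A \<inter> T (g k) ` B)) \<longlonglongrightarrow> measure M A * measure M B"
  shows "weakly_mixing M T"
proof -
  let ?N = "M \<Otimes>\<^sub>M M" and ?S = "\<lambda>g. map_prod (T g) (T g)"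
  interpret P: mp_action ?N ?S by (rule mp_action_product)
  let ?G = "{A \<times> B | A B. A \<in> sets M \<and> B \<in> sets M}"
  have G: "Int_stable ?G" "?G \<subseteq> Pow (space ?N)" "sets ?N = sigma_sets (space ?N) ?G"
    using pair_measure_closed[of M M] by (simp_all add: Int_stable_pair_measure_generator sets_pair_measure space_pair_measure)
  have GN: "C \<in> sets ?N" if "C \<in> ?G" for C using that by auto
  have spG: "space ?N \<in> ?G" by (auto simp: space_pair_measure)
  have rect: "(\<lambda>k. measure ?N (C \<inter> ?S (g k) ` D)) \<longlonglongrightarrow> measure ?N D * measure ?N C" if CD: "C \<in> ?G" "D \<in> ?G" for C D
  proof -
    obtain A B where C: "C = A \<times> B" "A \<in> sets M" "B \<in> sets M" using CD(1) by blast
    obtain A' B' where D: "D = A' \<times> B'" "A' \<in> sets M" "B' \<in> sets M" using CD(2) by blast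
    have "C \<inter> ?S (g k) ` D = (A \<inter> T (g k) ` A') \<times> (B \<inter> T (g k) ` B')" for k
      unfolding C D map_prod_surj_on[OF refl refl] by blast
    then have "measure ?N (C \<inter> ?S (g k) ` D) = measure M (A \<inter> T (g k) ` A') * measure M (B \<inter> T (g k) ` B')" for k
      using C D by (simp add: measure_product_Times)
    moreover have "(\<lambda>k. measure M (A \<inter> T (g k) ` A') * measure M (B \<inter> T (g k) ` B'))
        \<longlonglongrightarrow> (measure M A * measure M A') * (measure M B * measure M B')"
      by (intro tendsto_mult lim C D)
    ultimately show ?thesis using C D by (simp add: measure_product_Times mult_ac)
  qed
  have half: "(\<lambda>k. measure ?N (C \<inter> ?S (g k) ` D)) \<longlonglongrightarrow> measure ?N D * measure ?N C" if "C \<in> sets ?N" "D \<in> ?G" for C D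
  proof (rule P.measure_Int_tendsto_from_generator[OF G _ _ rect that(1)])
    show "(\<lambda>k. measure ?N (?S (g k) ` D)) \<longlonglongrightarrow> measure ?N D * measure ?N (space ?N)"
      using that GN by (simp add: P.measure_T_image P.prob_space)
  qed (use that GN in auto)
  have full: "(\<lambda>k. measure ?N (D \<inter> ?S (- g k) ` C)) \<longlonglongrightarrow> measure ?N C * measure ?N D" if C: "C \<in> sets ?N" and D: "D \<in> sets ?N" for C D
  proof (rule P.measure_Int_tendsto_from_generator[OF G _ _ _ D])
    show "(\<lambda>k. measure ?N (?S (- g k) ` C)) \<longlonglongrightarrow> measure ?N C * measure ?N (space ?N)"
      using C by (simp add: P.measure_T_image P.prob_space)
    show "(\<lambda>k. measure ?N (D \<inter> ?S (- g k) ` C)) \<longlonglongrightarrow> measure ?N C * measure ?N D" if "D \<in> ?G" for D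
      using half[OF C that] by (simp add: P.measure_T_shift[OF C GN[OF that]] mult.commute)
  qed (use C in auto)
  show ?thesis
    unfolding weakly_mixing_def ergodic_action_def
  proof (intro ballI impI)
    fix W assume W: "W \<in> sets ?N" "\<forall>g. ?S g -` W \<inter> space ?N = W"
    have "?S (- g k) ` W = W" for k using W by (metis P.T_vimage_eq)
    then have "(\<lambda>k. measure ?N W) \<longlonglongrightarrow> measure ?N W * measure ?N W"
      using full[OF W(1) W(1)] by simp
    then have "measure ?N W = measure ?N W * measure ?N W" by (rule LIMSEQ_unique[OF tendsto_const])
    then show "measure ?N W = 0 \<or> measure ?N W = 1" by auto
  qed
qed

end

section \<open>Sets of full density in infinite groups\<close>

text \<open>
  All translates of \<open>Z\<close> have asymptotically the same averages, and the averages of \<open>n\<close> disjoint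
  translates add up to at most 1.
\<close>
lemma full_density_Compl_if_disjoint_translates:
  fixes Z :: "'a::ab_group_add set"
  assumes H: "infinite H"
    and disj: "\<And>h h' g. h \<in> H \<Longrightarrow> h' \<in> H \<Longrightarrow> h + g \<in> Z \<Longrightarrow> h' + g \<in> Z \<Longrightarrow> h = h'"
  shows "full_density (- Z)"
  unfolding full_density_def
proof (intro allI impI)
  fix F :: "nat \<Rightarrow> 'a set" assume F: "folner_seq F"
  let ?a = "average F (indicat_real Z)"
  have "?a \<longlonglongrightarrow> 0"
  proof (rule order_tendstoI)
    fix e :: real assume "0 < e"
    \<comment> \<open>The sum of \<open>n\<close> averages is at most 1, up to an error below 1; hence the 2.\<close>
    obtain n :: nat where n: "2 / e < real n" using reals_Archimedean2 by blast
    then have "n > 0" using \<open>0 < e\<close> by (metis divide_pos_pos less_trans of_nat_0_less_iff zero_less_numeral)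
    obtain S where S: "finite S" "card S = n" "S \<subseteq> H" using infinite_arbitrarily_large[OF H] by blast
    have "(\<lambda>k. \<Sum>h\<in>S. average F (\<lambda>g. indicat_real Z (h + g)) k - ?a k) \<longlonglongrightarrow> (\<Sum>h\<in>S. 0)"
      by (intro tendsto_sum folner_average_shift F) (simp add: indicator_def)
    then have "\<forall>\<^sub>F k in sequentially. -1 < (\<Sum>h\<in>S. average F (\<lambda>g. indicat_real Z (h + g)) k - ?a k)"
      by (rule order_tendstoD) simp
    then show "\<forall>\<^sub>F k in sequentially. ?a k < e"
    proof eventually_elim
      case (elim k)
      have "\<bar>\<Sum>h\<in>S. indicat_real Z (h + g)\<bar> \<le> 1" for g
      proof (cases "\<exists>h\<in>S. h + g \<in> Z")
        case True
        then obtain h where h: "h \<in> S" "h + g \<in> Z" by blast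
        then have "(\<Sum>h'\<in>S. indicat_real Z (h' + g)) = (\<Sum>h'\<in>S. if h' = h then 1 else 0)"
          using disj[of h _ g] S(3) by (intro sum.cong) (auto simp: indicator_def)
        then show ?thesis using S(1) by simp
      qed (simp add: indicator_def)
      then have "(\<Sum>h\<in>S. average F (\<lambda>g. indicat_real Z (h + g)) k) \<le> 1"
        using abs_average_le[of "\<lambda>g. \<Sum>h\<in>S. indicat_real Z (h + g)" F k] by (simp add: average_sum)
      with elim have "real n * ?a k < 2" by (simp add: sum_subtractf S(2))
      moreover have "2 < real n * e" using n \<open>0 < e\<close> by (simp add: field_simps)
      ultimately have "real n * ?a k < real n * e" by linarith
      then show ?case using \<open>n > 0\<close> by simp
    qed
  next
    fix e :: real assume "e < 0"
    then show "\<forall>\<^sub>F k in sequentially. e < ?a k"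
      using average_indicator_bounds(1)[of F Z] by (intro always_eventually) (metis less_le_trans)
  qed
  then have "(\<lambda>k. average F (\<lambda>_. 1) k + (-1) * ?a k) \<longlonglongrightarrow> 1 + (-1) * 0"
    by (intro tendsto_intros average_const F)
  moreover have "(\<lambda>g. 1 + (-1) * indicat_real Z g) = indicat_real (- Z)"
    by (auto simp: indicator_def fun_eq_iff)
  ultimately show "average F (indicat_real (- Z)) \<longlonglongrightarrow> 1"
    by (simp only: average_add[symmetric] average_cmult[symmetric]) simp
qed

lemma full_density_avoid_finite:
  fixes p :: "'g::ab_group_add^'l::finite \<Rightarrow> 'g"
  assumes inf: "infinite (UNIV :: 'g set)" and fin: "finite S"
    and p: "\<And>x g. p (axis j x + g) = x + p g"
  shows "full_density {g. p g \<notin> S}"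
proof -
  \<comment> \<open>Translating by different vectors \<open>axis j x\<close> makes the fibres of \<open>p\<close> disjoint.\<close>
  have "inj (axis j :: 'g \<Rightarrow> 'g^'l)" by (rule injI) (metis axis_nth)
  then have H: "infinite (range (axis j :: 'g \<Rightarrow> 'g^'l))" using inf by (simp add: finite_image_iff)
  have "full_density (- {g. p g = a})" for a
    by (rule full_density_Compl_if_disjoint_translates[OF H]) (auto simp: p)
  then have "full_density (\<Inter>a\<in>S. - {g. p g = a})" by (intro full_density_INT fin)
  then show ?thesis by (rule full_density_mono) auto
qed

lemma positive_upper_density_meets_full_density:
  assumes F: "folner_seq F" and E: "upper_density F E > 0" and D: "full_density D"
  shows "E \<inter> D \<noteq> {}"
proof
  assume disj: "E \<inter> D = {}"
  obtain r \<delta> where r: "strict_mono (r :: nat \<Rightarrow> nat)" "\<delta> > 0" "\<And>k. average F (indicat_real E) (r k) \<ge> \<delta>"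
    using positive_upper_density_subseq[OF F E] by metis
  have "average (F \<circ> r) (indicat_real D) \<longlonglongrightarrow> 1"
    by (rule full_densityD[OF D folner_seq_subseq[OF F r(1)]])
  then have "\<forall>\<^sub>F k in sequentially. 1 - \<delta> < average (F \<circ> r) (indicat_real D) k"
    by (rule order_tendstoD) (use r in simp)
  then obtain k where "1 - \<delta> < average F (indicat_real D) (r k)"
    using eventually_happens'[OF sequentially_bot] by (auto simp: average_subseq)
  moreover have "average F (indicat_real E) (r k) + average F (indicat_real D) (r k) \<le> 1"
    unfolding average_add[symmetric]
    by (rule order_trans[OF average_mono average_indicator_bounds(2)[of F UNIV]])
       (use disj in \<open>auto simp: indicator_def\<close>)
  ultimately show False using r(3)[of k] by linarith
qed

section \<open>Invariant means along a Folner sequence\<close>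

text \<open>
  Along a filter \<open>U\<close> for which all densities converge, the limit \<open>\<nu>\<close> is a finitely additive
  translation-invariant probability on all subsets of the group.
\<close>
locale folner_mean =
  fixes F :: "nat \<Rightarrow> 'a::ab_group_add set" and U :: "nat filter" and \<nu> :: "'a set \<Rightarrow> real"
  assumes F: "folner_seq F"
    and U: "U \<le> sequentially" "U \<noteq> bot"
    and lim: "(average F (indicat_real B) \<longlongrightarrow> \<nu> B) U"
begin

text \<open>
  Linearity and monotonicity of \<open>\<nu>\<close> in one statement about simple functions.
\<close>
lemma mean_linear_le_set:
  assumes "finite I" "\<And>y. (\<Sum>i\<in>I. a i * indicat_real (C i) y) \<le> b + c * indicat_real B y"
  shows "(\<Sum>i\<in>I. a i * \<nu> (C i)) \<le> b + c * \<nu> B"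
proof (rule tendsto_le[OF U(2)])
  show "((\<lambda>k. average F (\<lambda>_. b) k + c * average F (indicat_real B) k) \<longlongrightarrow> b + c * \<nu> B) U"
    by (intro tendsto_intros lim tendsto_mono[OF U(1) average_const[OF F]])
  show "((\<lambda>k. \<Sum>i\<in>I. a i * average F (indicat_real (C i)) k) \<longlongrightarrow> (\<Sum>i\<in>I. a i * \<nu> (C i))) U"
    by (intro tendsto_intros lim)
  show "\<forall>\<^sub>F k in U. (\<Sum>i\<in>I. a i * average F (indicat_real (C i)) k) \<le> average F (\<lambda>_. b) k + c * average F (indicat_real B) k"
    unfolding average_cmult[symmetric] average_sum[symmetric] average_add[symmetric]
    by (intro always_eventually allI average_mono assms)
qed

lemma mean_linear_le:
  assumes "finite I" "\<And>y. (\<Sum>i\<in>I. a i * indicat_real (C i) y) \<le> b"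
  shows "(\<Sum>i\<in>I. a i * \<nu> (C i)) \<le> b"
  using mean_linear_le_set[of I a C b 0 "{}"] assms by simp

lemma mean_mono: "B \<subseteq> C \<Longrightarrow> \<nu> B \<le> \<nu> C"
  by (rule tendsto_le[OF U(2) lim lim]) (auto intro!: always_eventually average_mono simp: indicator_def)

lemma mean_shift: "\<nu> {y. x + y \<in> B} = \<nu> B"
proof -
  have "((\<lambda>k. average F (\<lambda>g. indicat_real B (x + g)) k - average F (indicat_real B) k) \<longlongrightarrow> 0) U"
    by (rule tendsto_mono[OF U(1) folner_average_shift[OF F]]) (simp add: indicator_def)
  moreover have "(\<lambda>g. indicat_real B (x + g)) = indicat_real {y. x + y \<in> B}"
    by (simp add: indicator_def fun_eq_iff)
  ultimately have "((\<lambda>k. average F (indicat_real {y. x + y \<in> B}) k - average F (indicat_real B) k) \<longlongrightarrow> 0) U"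
    by simp
  from tendsto_unique[OF U(2) tendsto_diff[OF lim lim] this] show ?thesis by simp
qed

lemma mean_full_density:
  assumes "full_density D"
  shows "\<nu> D = 1"
  by (rule tendsto_unique[OF U(2) lim tendsto_mono[OF U(1) full_densityD[OF assms F]]])

lemma mean_UN_le:
  assumes "finite I"
  shows "\<nu> (\<Union>i\<in>I. C i) \<le> (\<Sum>i\<in>I. \<nu> (C i))"
proof (rule tendsto_le[OF U(2) tendsto_sum[OF lim] lim])
  have "indicat_real (\<Union>i\<in>I. C i) y \<le> (\<Sum>i\<in>I. indicat_real (C i) y)" for y
  proof (cases "y \<in> (\<Union>i\<in>I. C i)")
    case True
    then obtain i where "i \<in> I" "y \<in> C i" by blast
    then show ?thesis
      using member_le_sum[of i I "\<lambda>i. indicat_real (C i) y"] assms by (auto simp: indicator_def)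
  qed (simp add: sum_nonneg)
  then show "\<forall>\<^sub>F k in U. average F (indicat_real (\<Union>i\<in>I. C i)) k \<le> (\<Sum>i\<in>I. average F (indicat_real (C i)) k)"
    unfolding average_sum[symmetric] by (intro always_eventually allI average_mono)
qed

lemma mean_disjoint:
  assumes "B \<inter> C = {}"
  shows "\<nu> B + \<nu> C \<le> 1"
proof -
  have "(\<Sum>b\<in>{True, False}. 1 * indicat_real (if b then B else C) y) \<le> 1" for y
    using assms by simp (auto simp: indicator_def)
  from mean_linear_le[OF _ this] show ?thesis by simp
qed

text \<open>
  A Bonferroni inequality. A point in exactly \<open>s\<close> of the sets contributes \<open>2 s - s (s - 1)\<close> to the sum
  of the \<open>2 \<nu> (C i)\<close> minus that of the \<open>\<nu> (C i \<inter> C j)\<close> over ordered pairs \<open>i \<noteq> j\<close>, and for integers this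
  is at most 2.
\<close>
lemma mean_overlap:
  assumes "finite S" "\<And>i. i \<in> S \<Longrightarrow> \<nu> (C i) \<ge> \<eta>"
    and "\<And>i j. i \<in> S \<Longrightarrow> j \<in> S \<Longrightarrow> i \<noteq> j \<Longrightarrow> \<nu> (C i \<inter> C j) \<le> \<epsilon>"
    and "\<epsilon> \<ge> 0"
  shows "2 * real (card S) * \<eta> \<le> 2 + (real (card S))\<^sup>2 * \<epsilon>"
proof -
  let ?I = "S \<times> S" and ?C = "\<lambda>(i, j). C i \<inter> C j"
  let ?a = "\<lambda>(i, j). if i = j then 2 else - 1 :: real"
  have "(\<Sum>p\<in>?I. ?a p * \<nu> (?C p)) \<le> 2"
  proof (rule mean_linear_le)
    fix y
    define R where "R = {i \<in> S. y \<in> C i}"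
    have R: "finite R" using assms(1) by (simp add: R_def)
    have "(\<Sum>p\<in>?I. ?a p * indicat_real (?C p) y) = (\<Sum>p\<in>R \<times> R. ?a p)"
      by (rule sum.mono_neutral_cong_right) (use assms(1) in \<open>auto simp: R_def indicator_def\<close>)
    also have "\<dots> = (\<Sum>i\<in>R. \<Sum>j\<in>R. (if i = j then 3 else 0) - 1)"
      by (subst sum.cartesian_product[symmetric]) (intro sum.cong refl; simp)
    also have "\<dots> = 3 * real (card R) - (real (card R))\<^sup>2"
      using R by (simp add: sum_subtractf power2_eq_square algebra_simps)
    \<comment> \<open>\<open>(s - 1) (s - 2) \<ge> 0\<close> holds for integers, though not for all reals.\<close>
    also have "\<dots> \<le> 2"
    proof -
      have "0 \<le> (int (card R) - 1) * (int (card R) - 2)"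
        by (cases "int (card R) \<le> 1") (auto intro: mult_nonpos_nonpos mult_nonneg_nonneg)
      then have "0 \<le> real_of_int ((int (card R) - 1) * (int (card R) - 2))" by (simp only: of_int_0_le_iff)
      then show ?thesis by (simp add: power2_eq_square algebra_simps)
    qed
    finally show "(\<Sum>p\<in>?I. ?a p * indicat_real (?C p) y) \<le> 2" .
  qed (use assms(1) in simp)
  moreover have "(\<Sum>p\<in>?I. (if fst p = snd p then 2 * \<eta> else 0) - \<epsilon>) \<le> (\<Sum>p\<in>?I. ?a p * \<nu> (?C p))"
  proof (rule sum_mono)
    fix p assume "p \<in> ?I"
    then show "(if fst p = snd p then 2 * \<eta> else 0) - \<epsilon> \<le> ?a p * \<nu> (?C p)"
      using assms(2)[of "fst p"] assms(3)[of "fst p" "snd p"] assms(4) by (auto simp: split_beta)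
  qed
  moreover have "(\<Sum>p\<in>?I. (if fst p = snd p then 2 * \<eta> else 0) - \<epsilon>) = 2 * real (card S) * \<eta> - (real (card S))\<^sup>2 * \<epsilon>"
    using assms(1) by (simp add: sum_subtractf power2_eq_square card_cartesian_product sum.cartesian_product' sum.delta)
  ultimately show ?thesis by linarith
qed

end

section \<open>Intersectivity of sets of positive upper density\<close>

context folner_mean
begin

definition pattern :: "'a set \<Rightarrow> 'a set \<Rightarrow> 'a set" where
  "pattern E S = {y. \<forall>s\<in>S. s + y \<in> E}"

text \<open>
  The elements \<open>y\<close> for which the shift of \<open>E\<close> by \<open>-y\<close> fills at least the proportion \<open>\<delta>\<close> of \<open>F n\<close>.
\<close>
definition rich :: "'a set \<Rightarrow> real \<Rightarrow> nat \<Rightarrow> 'a set" where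
  "rich E \<delta> n = {y. \<delta> * real (card (F n)) \<le> real (card {x \<in> F n. x + y \<in> E})}"

text \<open>
  A notion of largeness that survives both intersecting with a further rich set
  (\<open>recurrent_Int_rich\<close>) and passing to some part of a finite partition (\<open>recurrent_UN\<close>). Positivity of
  \<open>\<nu> C\<close> alone does not survive the former, since rich sets could avoid \<open>C\<close>.
\<close>
definition recurrent :: "'a set \<Rightarrow> real \<Rightarrow> 'a set \<Rightarrow> bool" where
  "recurrent E \<delta> C \<longleftrightarrow> (\<exists>\<eta>>0. \<exists>\<^sub>F n in sequentially. \<eta> \<le> \<nu> (C \<inter> rich E \<delta> n))"

text \<open>
  By invariance \<open>2 \<delta>\<close> bounds from below the mean over \<open>y\<close> of the proportion of \<open>F n\<close> filled by the
  shift of \<open>E\<close>. This proportion is at most \<open>\<delta>\<close> off the rich set and at most 1 on it.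
\<close>
lemma mean_rich_ge:
  assumes E: "\<nu> E \<ge> 2 * \<delta>" and "\<delta> \<ge> 0" "n \<ge> 1"
  shows "\<delta> \<le> \<nu> (rich E \<delta> n)"
proof -
  have fin: "finite (F n)" and pos: "card (F n) > 0" using folner_seqD[OF F \<open>n \<ge> 1\<close>] by auto
  let ?c = "real (card (F n))"
  have "(\<Sum>x\<in>F n. 1 * \<nu> {y. x + y \<in> E}) \<le> \<delta> * ?c + ?c * \<nu> (rich E \<delta> n)"
  proof (rule mean_linear_le_set[OF fin])
    fix y
    have "(\<Sum>x\<in>F n. 1 * indicat_real {y. x + y \<in> E} y) = real (card {x \<in> F n. x + y \<in> E})"
      using fin by (simp add: indicator_def sum.If_cases Int_def)
    also have "\<dots> \<le> \<delta> * ?c + ?c * indicat_real (rich E \<delta> n) y"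
    proof (cases "y \<in> rich E \<delta> n")
      case True
      have "card {x \<in> F n. x + y \<in> E} \<le> card (F n)" using fin by (intro card_mono) auto
      then have "real (card {x \<in> F n. x + y \<in> E}) \<le> ?c" by simp
      moreover have "0 \<le> \<delta> * ?c" using \<open>\<delta> \<ge> 0\<close> by simp
      ultimately show ?thesis using True by simp
    qed (simp add: rich_def)
    finally show "(\<Sum>x\<in>F n. 1 * indicat_real {y. x + y \<in> E} y) \<le> \<delta> * ?c + ?c * indicat_real (rich E \<delta> n) y" .
  qed
  then have "?c * \<nu> E \<le> \<delta> * ?c + ?c * \<nu> (rich E \<delta> n)" by (simp add: mean_shift)
  moreover have "?c * (2 * \<delta>) \<le> ?c * \<nu> E" using E by (intro mult_left_mono) auto
  ultimately have "?c * \<delta> \<le> ?c * \<nu> (rich E \<delta> n)" by (simp add: algebra_simps)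
  then show ?thesis using pos by simp
qed

lemma recurrent_imp_positive:
  assumes "recurrent E \<delta> C"
  shows "\<nu> C > 0"
proof -
  obtain \<eta> n where "\<eta> > 0" "\<eta> \<le> \<nu> (C \<inter> rich E \<delta> n)"
    using assms unfolding recurrent_def by (auto dest: frequently_ex)
  then show ?thesis using mean_mono[of "C \<inter> rich E \<delta> n" C] by auto
qed

lemma eventually_small_if_not_recurrent:
  assumes "\<not> recurrent E \<delta> C" "\<eta> > 0"
  shows "\<forall>\<^sub>F n in sequentially. \<nu> (C \<inter> rich E \<delta> n) < \<eta>"
  using assms by (auto simp: recurrent_def frequently_def not_le)

text \<open>
  Otherwise the sets \<open>C \<inter> rich E \<delta> n\<close> of mass at least \<open>\<eta>\<close> would have negligible overlap with all but
  finitely many others. Picking them greedily gives \<open>m > 2 / \<eta>\<close> of them with pairwise overlaps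
  at most \<open>1 / m\<^sup>2\<close>, and \<open>mean_overlap\<close> would yield \<open>2 m \<eta> \<le> 3\<close>.
\<close>
lemma recurrent_Int_rich:
  assumes "recurrent E \<delta> C"
  shows "\<exists>n>N. recurrent E \<delta> (C \<inter> rich E \<delta> n)"
proof (rule ccontr)
  assume "\<not> ?thesis"
  then have not: "\<not> recurrent E \<delta> (C \<inter> rich E \<delta> n)" if "n > N" for n
    using that by blast
  obtain \<eta> where \<eta>: "\<eta> > 0" "\<exists>\<^sub>F n in sequentially. \<eta> \<le> \<nu> (C \<inter> rich E \<delta> n)"
    using assms unfolding recurrent_def by blast
  obtain m :: nat where m: "2 / \<eta> < real m" using reals_Archimedean2 by blast
  then have "m > 0" using \<eta>(1) by (metis divide_pos_pos less_trans of_nat_0_less_iff zero_less_numeral)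
  define \<epsilon> where "\<epsilon> = 1 / (real m)\<^sup>2"
  have \<epsilon>: "\<epsilon> > 0" using \<open>m > 0\<close> by (simp add: \<epsilon>_def)
  let ?C = "\<lambda>n. C \<inter> rich E \<delta> n"
  have "\<exists>S. finite S \<and> card S = r \<and> (\<forall>n\<in>S. n > N \<and> \<eta> \<le> \<nu> (?C n)) \<and>
      (\<forall>i\<in>S. \<forall>j\<in>S. i \<noteq> j \<longrightarrow> \<nu> (?C i \<inter> ?C j) \<le> \<epsilon>)" for r
  proof (induction r)
    case (Suc r)
    then obtain S where S: "finite S" "card S = r" "\<forall>n\<in>S. n > N \<and> \<eta> \<le> \<nu> (?C n)"
      "\<forall>i\<in>S. \<forall>j\<in>S. i \<noteq> j \<longrightarrow> \<nu> (?C i \<inter> ?C j) \<le> \<epsilon>" by blast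
    have "\<forall>\<^sub>F n in sequentially. \<forall>i\<in>S. \<nu> (?C i \<inter> rich E \<delta> n) < \<epsilon>"
      using S(1,3) not eventually_small_if_not_recurrent[OF _ \<epsilon>]
      by (intro eventually_ball_finite) auto
    moreover have "\<forall>\<^sub>F n in sequentially. n > N \<and> n \<notin> S"
    proof (rule eventually_conj[OF eventually_gt_at_top])
      show "\<forall>\<^sub>F n in sequentially. n \<notin> S"
        using S(1) by (auto simp: eventually_sequentially finite_nat_set_iff_bounded not_less[symmetric])
    qed
    ultimately have "\<forall>\<^sub>F n in sequentially. (\<forall>i\<in>S. \<nu> (?C i \<inter> rich E \<delta> n) < \<epsilon>) \<and> n > N \<and> n \<notin> S"
      by (rule eventually_conj)
    with \<eta>(2) have "\<exists>\<^sub>F n in sequentially. \<eta> \<le> \<nu> (?C n) \<and> (\<forall>i\<in>S. \<nu> (?C i \<inter> rich E \<delta> n) < \<epsilon>) \<and> n > N \<and> n \<notin> S"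
      by (rule frequently_eventually_frequently)
    then obtain n where n: "\<eta> \<le> \<nu> (?C n)" "\<forall>i\<in>S. \<nu> (?C i \<inter> rich E \<delta> n) < \<epsilon>" "n > N" "n \<notin> S"
      by (auto dest: frequently_ex)
    have eq: "?C i \<inter> ?C n = ?C i \<inter> rich E \<delta> n" "?C n \<inter> ?C i = ?C i \<inter> rich E \<delta> n" for i by auto
    show ?case
      by (rule exI[of _ "insert n S"]) (use S n in \<open>auto simp: eq less_imp_le\<close>)
  qed (intro exI[of _ "{}"], simp)
  from this[of m] obtain S where S: "finite S" "card S = m" "\<forall>n\<in>S. n > N \<and> \<eta> \<le> \<nu> (?C n)"
      "\<forall>i\<in>S. \<forall>j\<in>S. i \<noteq> j \<longrightarrow> \<nu> (?C i \<inter> ?C j) \<le> \<epsilon>" by blast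
  have "2 * real m * \<eta> \<le> 2 + (real m)\<^sup>2 * \<epsilon>"
    using mean_overlap[of S \<eta> ?C \<epsilon>] S \<epsilon> by auto
  also have "\<dots> = 3" using \<open>m > 0\<close> by (simp add: \<epsilon>_def)
  finally show False using m \<eta>(1) by (simp add: field_simps)
qed

lemma recurrent_UN:
  assumes "finite I" "recurrent E \<delta> (\<Union>i\<in>I. C i)"
  shows "\<exists>i\<in>I. recurrent E \<delta> (C i)"
proof (rule ccontr)
  assume "\<not> ?thesis"
  then have not: "\<not> recurrent E \<delta> (C i)" if "i \<in> I" for i using that by blast
  obtain \<eta> where \<eta>: "\<eta> > 0" "\<exists>\<^sub>F n in sequentially. \<eta> \<le> \<nu> ((\<Union>i\<in>I. C i) \<inter> rich E \<delta> n)"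
    using assms unfolding recurrent_def by blast
  define \<epsilon> where "\<epsilon> = \<eta> / (real (card I) + 1)"
  have \<epsilon>: "\<epsilon> > 0" using \<eta>(1) by (simp add: \<epsilon>_def add_nonneg_pos)
  have "\<forall>\<^sub>F n in sequentially. \<forall>i\<in>I. \<nu> (C i \<inter> rich E \<delta> n) < \<epsilon>"
    using assms(1) not eventually_small_if_not_recurrent[OF _ \<epsilon>]
    by (intro eventually_ball_finite) auto
  with \<eta>(2) have "\<exists>\<^sub>F n in sequentially. \<eta> \<le> \<nu> ((\<Union>i\<in>I. C i) \<inter> rich E \<delta> n) \<and> (\<forall>i\<in>I. \<nu> (C i \<inter> rich E \<delta> n) < \<epsilon>)"
    by (rule frequently_eventually_frequently)
  then obtain n where n: "\<eta> \<le> \<nu> ((\<Union>i\<in>I. C i) \<inter> rich E \<delta> n)" "\<forall>i\<in>I. \<nu> (C i \<inter> rich E \<delta> n) < \<epsilon>"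
    by (auto dest: frequently_ex)
  have "\<eta> \<le> (\<Sum>i\<in>I. \<nu> (C i \<inter> rich E \<delta> n))"
    using n(1) mean_UN_le[OF assms(1), of "\<lambda>i. C i \<inter> rich E \<delta> n"] by simp
  also have "\<dots> \<le> real (card I) * \<epsilon>"
    by (rule sum_bounded_above) (use n(2) in \<open>auto simp: less_imp_le\<close>)
  also have "\<dots> < \<eta>" using \<eta>(1) by (simp add: \<epsilon>_def field_simps)
  finally show False by simp
qed

text \<open>
  Inside \<open>pattern E P\<close>, the rich set is a finite union of patterns of \<open>P \<union> S\<close> with \<open>S\<close> a large subset of
  \<open>F n\<close>, and one of these patterns stays recurrent.
\<close>
lemma extend_pattern:
  assumes "recurrent E \<delta> (pattern E P)" "finite P"
  shows "\<exists>Q. finite Q \<and> recurrent E \<delta> (pattern E Q) \<and> P \<subseteq> Q \<and>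
    (\<exists>n>N. \<delta> * real (card (F n)) \<le> real (card (Q \<inter> F n)))"
proof -
  obtain n where n: "n > N" "recurrent E \<delta> (pattern E P \<inter> rich E \<delta> n)"
    using recurrent_Int_rich[OF assms(1)] by blast
  then have fin: "finite (F n)" using folner_seqD[OF F, of n] by simp
  let ?I = "{S. S \<subseteq> F n \<and> \<delta> * real (card (F n)) \<le> real (card S)}"
  have "pattern E P \<inter> rich E \<delta> n = (\<Union>S\<in>?I. pattern E (P \<union> S))"
  proof (intro equalityI subsetI)
    fix y assume "y \<in> pattern E P \<inter> rich E \<delta> n"
    then show "y \<in> (\<Union>S\<in>?I. pattern E (P \<union> S))"
      by (intro UN_I[of "{x \<in> F n. x + y \<in> E}"]) (auto simp: pattern_def rich_def)
  next
    fix y assume "y \<in> (\<Union>S\<in>?I. pattern E (P \<union> S))"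
    then obtain S where S: "S \<subseteq> F n" "\<delta> * real (card (F n)) \<le> real (card S)" "y \<in> pattern E (P \<union> S)" by blast
    have "card S \<le> card {x \<in> F n. x + y \<in> E}"
      using S fin by (intro card_mono) (auto simp: pattern_def)
    then show "y \<in> pattern E P \<inter> rich E \<delta> n" using S(2,3) by (auto simp: pattern_def rich_def)
  qed
  with n(2) have "recurrent E \<delta> (\<Union>S\<in>?I. pattern E (P \<union> S))" by simp
  moreover have "finite ?I" using fin by simp
  ultimately obtain S where S: "S \<in> ?I" "recurrent E \<delta> (pattern E (P \<union> S))"
    using recurrent_UN[of ?I E \<delta> "\<lambda>S. pattern E (P \<union> S)"] by blast
  have "card S \<le> card ((P \<union> S) \<inter> F n)" using S(1) fin by (intro card_mono) auto
  then have "\<delta> * real (card (F n)) \<le> real (card ((P \<union> S) \<inter> F n))" using S(1) by simp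
  moreover have "finite (P \<union> S)" using S(1) fin assms(2) by (auto intro: finite_subset)
  ultimately show ?thesis using S(2) n(1) by blast
qed

text \<open>
  Extending patterns again and again gives an increasing sequence of finite sets \<open>P k\<close> whose
  patterns have positive mean, and which fill the proportion \<open>\<delta>\<close> of infinitely many \<open>F n\<close>. Their union is
  \<open>E'\<close>: a finite part of it lies in some \<open>P k\<close>, and a pattern of positive mean meets every set of mean 1.
\<close>
theorem intersectivity:
  assumes E: "\<nu> E \<ge> 2 * \<delta>" and \<delta>: "\<delta> > 0"
  obtains E' where "upper_density F E' > 0"
    "\<And>S D. finite S \<Longrightarrow> S \<subseteq> E' \<Longrightarrow> full_density D \<Longrightarrow> \<exists>y\<in>D. \<forall>s\<in>S. s + y \<in> E"
proof -
  define Good where "Good = (\<lambda>P. finite P \<and> recurrent E \<delta> (pattern E P))"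
  have "\<delta> \<le> \<nu> (UNIV \<inter> rich E \<delta> n)" if "n \<ge> 1" for n
    using mean_rich_ge[OF E _ that] \<delta> by simp
  then have "\<forall>\<^sub>F n in sequentially. \<delta> \<le> \<nu> (UNIV \<inter> rich E \<delta> n)"
    by (intro eventually_mono[OF eventually_ge_at_top[of 1]])
  then have "recurrent E \<delta> UNIV"
    unfolding recurrent_def using \<delta> eventually_frequently[OF sequentially_bot] by blast
  then have "Good {}" by (simp add: Good_def pattern_def)
  moreover have "\<exists>Q. Good Q \<and> (P \<subseteq> Q \<and> (\<exists>n>N. \<delta> * real (card (F n)) \<le> real (card (Q \<inter> F n))))"
    if "Good P" for P N
    using extend_pattern[of E \<delta> P N] that unfolding Good_def by blast
  ultimately obtain P where P: "\<And>k. Good (P k)" "\<And>k. P k \<subseteq> P (Suc k)"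
      "\<And>k. \<exists>n>k. \<delta> * real (card (F n)) \<le> real (card (P (Suc k) \<inter> F n))"
    using dependent_nat_choice[of "\<lambda>_. Good" "\<lambda>N P Q. P \<subseteq> Q \<and> (\<exists>n>N. \<delta> * real (card (F n)) \<le> real (card (Q \<inter> F n)))"]
    by metis
  define E' where "E' = (\<Union>k. P k)"
  show thesis
  proof (rule that)
    show "upper_density F E' > 0"
    proof (rule ccontr)
      assume "\<not> upper_density F E' > 0"
      also have "\<not> 0 < upper_density F E' \<longleftrightarrow> upper_density F E' \<le> 0" by (simp add: not_less)
      finally have "upper_density F E' < ereal \<delta>" using \<delta> by (metis ereal_less(2) order_le_less_trans)
      then have "\<forall>\<^sub>F n in sequentially. ereal (average F (indicat_real E') n) < ereal \<delta>"
        unfolding upper_density_eq_limsup_average[OF F] by (rule Limsup_lessD)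
      then obtain k where k: "\<And>n. n \<ge> k \<Longrightarrow> average F (indicat_real E') n < \<delta>"
        by (auto simp: eventually_sequentially)
      obtain n where n: "n > k" "\<delta> * real (card (F n)) \<le> real (card (P (Suc k) \<inter> F n))" using P(3) by blast
      have fin: "finite (F n)" "card (F n) > 0" using folner_seqD[OF F, of n] n(1) by auto
      have "card (P (Suc k) \<inter> F n) \<le> card (E' \<inter> F n)"
        using fin by (intro card_mono) (auto simp: E'_def)
      with n(2) have "\<delta> \<le> average F (indicat_real E') n"
        using fin by (simp add: average_indicator pos_le_divide_eq)
      with k[of n] n(1) show False by simp
    qed
    fix S D :: "'a set" assume S: "finite S" "S \<subseteq> E'" and D: "full_density D"
    have "\<exists>k. S \<subseteq> P k"
      using S
    proof (induction S)
      case (insert s S)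
      then obtain k l where "S \<subseteq> P k" "s \<in> P l" by (auto simp: E'_def)
      moreover have "P k \<subseteq> P (max k l)" "P l \<subseteq> P (max k l)"
        by (simp_all add: lift_Suc_mono_le[of P, OF P(2)])
      ultimately show ?case by blast
    qed simp
    then obtain k where "S \<subseteq> P k" by blast
    then have "pattern E (P k) \<subseteq> pattern E S" by (auto simp: pattern_def)
    moreover have "\<nu> (pattern E (P k)) > 0" using P(1)[of k] recurrent_imp_positive[of E \<delta>] by (simp add: Good_def)
    ultimately have "\<nu> (pattern E S) > 0" using mean_mono by (metis order_less_le_trans)
    then have "pattern E S \<inter> D \<noteq> {}"
      using mean_disjoint[of "pattern E S" D] mean_full_density[OF D] by auto
    then show "\<exists>y\<in>D. \<forall>s\<in>S. s + y \<in> E" by (auto simp: pattern_def)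
  qed
qed

end

lemma positive_upper_density_intersectivity:
  assumes F: "folner_seq F" and E: "upper_density F E > 0"
  obtains F' E' where "folner_seq F'" "upper_density F' E' > 0"
    "\<And>S D. finite S \<Longrightarrow> S \<subseteq> E' \<Longrightarrow> full_density D \<Longrightarrow> \<exists>y\<in>D. \<forall>s\<in>S. s + y \<in> E"
proof -
  obtain r \<delta> where r: "strict_mono (r :: nat \<Rightarrow> nat)" "\<delta> > 0" "\<And>k. average F (indicat_real E) (r k) \<ge> \<delta>"
    using positive_upper_density_subseq[OF F E] by metis
  have F': "folner_seq (F \<circ> r)" by (rule folner_seq_subseq[OF F r(1)])
  have "\<bar>average (F \<circ> r) (indicat_real B) k\<bar> \<le> 1" for k B
    by (rule abs_average_le) (simp add: indicator_def)
  then obtain V \<nu> where V: "V \<le> sequentially" "V \<noteq> bot" "\<And>B. ((\<lambda>k. average (F \<circ> r) (indicat_real B) k) \<longlongrightarrow> \<nu> B) V"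
    using cluster_functional[of "\<lambda>k B. average (F \<circ> r) (indicat_real B) k" sequentially] sequentially_bot by blast
  interpret folner_mean "F \<circ> r" V \<nu>
    by standard (use F' V in auto)
  have "\<delta> \<le> \<nu> E"
    by (rule tendsto_lowerbound[OF V(3) always_eventually V(2)]) (use r(3) in \<open>simp add: average_subseq\<close>)
  then show thesis
    using intersectivity[of "\<delta> / 2" E] r(2) that[OF F'] by auto
qed

section \<open>Sums inside sets of positive upper density\<close>

lemma msubsets_Suc_cases:
  assumes "\<alpha> \<in> msubsets (Suc m)"
  obtains \<beta> k where "\<beta> \<in> msubsets m" "k \<ge> 1" "\<beta> \<subseteq> {..<k}"
    "\<And>v. set_sum (Suc m) v \<alpha> = set_sum m v \<beta> + v k (Suc m)"
proof -
  have \<alpha>: "finite \<alpha>" "\<alpha> \<subseteq> {1..}" "card \<alpha> = Suc m" "\<alpha> \<noteq> {}" using assms by (auto simp: msubsets_def)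
  define k where "k = Max \<alpha>"
  define \<beta> where "\<beta> = \<alpha> - {k}"
  have k: "k \<in> \<alpha>" using \<alpha> by (simp add: k_def)
  have lt: "\<beta> \<subseteq> {..<k}" using \<alpha> by (auto simp: \<beta>_def k_def intro: le_neq_trans)
  have \<beta>: "\<beta> \<in> msubsets m" using \<alpha> k by (auto simp: msubsets_def \<beta>_def)
  have "sorted_list_of_set \<alpha> = sorted_list_of_set \<beta> @ [k]"
  proof (rule sorted_distinct_set_unique)
    show "sorted (sorted_list_of_set \<beta> @ [k])" "distinct (sorted_list_of_set \<beta> @ [k])"
      using lt \<alpha>(1) by (auto simp: sorted_append \<beta>_def)
    show "set (sorted_list_of_set \<alpha>) = set (sorted_list_of_set \<beta> @ [k])"
      using \<alpha>(1) k by (auto simp: \<beta>_def)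
  qed auto
  moreover have "length (sorted_list_of_set \<beta>) = m" using \<beta> by (simp add: msubsets_def)
  ultimately have "set_sum (Suc m) v \<alpha> = set_sum m v \<beta> + v k (Suc m)" for v
    unfolding set_sum_def sum.nat_ivl_Suc' by (auto simp: nth_append intro!: sum.cong)
  with \<beta> lt k \<alpha>(2) show thesis by (intro that) auto
qed

lemma msubsets_1: "\<alpha> \<in> msubsets 1 \<Longrightarrow> \<exists>k\<ge>1. \<alpha> = {k}"
  by (auto simp: msubsets_def card_1_singleton_iff)

text \<open>
  Induction on \<open>m\<close>. The first \<open>m\<close> coordinates are chosen so that their sums lie in the set \<open>E'\<close> given by
  intersectivity. The last coordinate with index \<open>k\<close> has to bring into \<open>E\<close> just those sums whose
  indices are below \<open>k\<close>; they are finitely many elements of \<open>E'\<close>, so it can be found in \<open>D k\<close>.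
\<close>
theorem positive_upper_density_contains_sums:
  fixes F :: "nat \<Rightarrow> 'a::ab_group_add set"
  assumes "m \<ge> 1" "folner_seq F" "upper_density F E > 0" and D: "\<And>k. full_density (D k)"
  obtains v :: "nat \<Rightarrow> nat \<Rightarrow> 'a" where "\<And>k t. t \<in> {1..m} \<Longrightarrow> v k t \<in> D k" "\<And>\<alpha>. \<alpha> \<in> msubsets m \<Longrightarrow> set_sum m v \<alpha> \<in> E"
proof -
  have "\<exists>v. (\<forall>k. \<forall>t\<in>{1..m}. v k t \<in> D k) \<and> (\<forall>\<alpha>\<in>msubsets m. set_sum m v \<alpha> \<in> E)"
    using assms(1-3)
  proof (induction m arbitrary: F E rule: dec_induct)
    case base
    have "\<forall>k. \<exists>y. y \<in> E \<inter> D k"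
      using positive_upper_density_meets_full_density[OF base D] by blast
    then obtain y where "\<And>k. y k \<in> E \<inter> D k" by metis
    then show ?case
      by (intro exI[of _ "\<lambda>k t. y k"]) (auto simp: set_sum_def dest!: msubsets_1)
  next
    case (step m)
    obtain F' E' where E': "folner_seq F'" "upper_density F' E' > 0"
      "\<And>S D. finite S \<Longrightarrow> S \<subseteq> E' \<Longrightarrow> full_density D \<Longrightarrow> \<exists>y\<in>D. \<forall>s\<in>S. s + y \<in> E"
      using positive_upper_density_intersectivity[OF step.prems] by metis
    obtain v where v: "\<And>k t. t \<in> {1..m} \<Longrightarrow> v k t \<in> D k" "\<And>\<alpha>. \<alpha> \<in> msubsets m \<Longrightarrow> set_sum m v \<alpha> \<in> E'"
      using step.IH[OF E'(1,2)] by blast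
    define S where "S k = set_sum m v ` {\<beta> \<in> msubsets m. \<beta> \<subseteq> {..<k}}" for k
    have "finite {\<beta> \<in> msubsets m. \<beta> \<subseteq> {..<k}}" for k
      by (rule finite_subset[of _ "Pow {..<k}"]) auto
    then have "finite (S k)" for k by (simp add: S_def)
    moreover have "S k \<subseteq> E'" for k using v(2) by (auto simp: S_def)
    ultimately have "\<exists>y\<in>D k. \<forall>s\<in>S k. s + y \<in> E" for k by (rule E'(3)[OF _ _ D])
    then obtain y where y: "\<And>k. y k \<in> D k" "\<And>k s. s \<in> S k \<Longrightarrow> s + y k \<in> E" by metis
    define w where "w k t = (if t = Suc m then y k else v k t)" for k t
    have w: "set_sum m w \<beta> = set_sum m v \<beta>" for \<beta>
      unfolding set_sum_def w_def by (intro sum.cong) auto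
    have "w k t \<in> D k" if "t \<in> {1..Suc m}" for k t
      using that v(1)[of t k] y(1)[of k] by (auto simp: w_def le_Suc_eq)
    moreover have "set_sum (Suc m) w \<alpha> \<in> E" if "\<alpha> \<in> msubsets (Suc m)" for \<alpha>
    proof (rule msubsets_Suc_cases[OF that])
      fix \<beta> k assume "\<beta> \<in> msubsets m" "\<beta> \<subseteq> {..<k}"
        and sum: "\<And>v :: nat \<Rightarrow> nat \<Rightarrow> 'a. set_sum (Suc m) v \<alpha> = set_sum m v \<beta> + v k (Suc m)"
      then have "set_sum m v \<beta> \<in> S k" by (auto simp: S_def)
      then have "set_sum m v \<beta> + y k \<in> E" by (rule y(2))
      then show ?thesis by (simp add: sum w) (simp add: w_def)
    qed
    ultimately show ?case by blast
  qed
  then show thesis using that by blast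
qed

section \<open>Test sets for convergence of correlations\<close>

context mp_system
begin

interpretation mp_action M T by (rule is_mp_action)

text \<open>
  Enumerate a countable generator. The set \<open>D k\<close> controls, with error \<open>1/(k+1)\<close>, the finitely many
  correlations of tuples formed from its first \<open>k + 1\<close> members; each fixed tuple is covered from some \<open>k\<close> on.
\<close>
lemma mixing_test_sets:
  assumes R: "\<And>A0 (A :: 'l::finite \<Rightarrow> 'x set) \<epsilon>. A0 \<in> sets M \<Longrightarrow> (\<And>j. A j \<in> sets M) \<Longrightarrow> \<epsilon> > 0 \<Longrightarrow>
      full_density (R_set M T \<epsilon> A0 A)"
  obtains D :: "nat \<Rightarrow> ('g^'l) set" where "\<And>k. full_density (D k)"
    "\<And>(g :: nat \<Rightarrow> 'g^'l) A0 A. (\<And>k. g k \<in> D k) \<Longrightarrow> A0 \<in> sets M \<Longrightarrow> (\<And>j. A j \<in> sets M) \<Longrightarrow>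
      (\<lambda>k. multi_corr M T A0 A (g k)) \<longlonglongrightarrow> measure M A0 * (\<Prod>j\<in>UNIV. measure M (A j))"
proof -
  obtain G where G: "countable G" "Int_stable G" "space M \<in> G" "G \<subseteq> Pow (space M)" "sets M = sigma_sets (space M) G"
    by (rule countable_generator)
  have GM: "B \<in> sets M" if "B \<in> G" for B using that by (simp add: G(5) sigma_sets.Basic)
  define e where "e = from_nat_into G"
  have e: "range e = G" unfolding e_def using G(1,3) by (intro range_from_nat_into) auto
  then have eM: "e n \<in> sets M" for n using GM by blast
  define D :: "nat \<Rightarrow> ('g^'l) set" where
    "D k = (\<Inter>p\<in>{..k} \<times> (UNIV \<rightarrow>\<^sub>E {..k}). R_set M T (1 / real (Suc k)) (e (fst p)) (\<lambda>j. e (snd p j)))" for k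
  show thesis
  proof (rule that[of D])
    show "full_density (D k)" for k
      unfolding D_def
      by (rule full_density_INT) (auto intro!: finite_PiE finite_cartesian_product R eM)
    fix g :: "nat \<Rightarrow> 'g^'l" and A0 and A :: "'l \<Rightarrow> 'x set"
    assume g: "\<And>k. g k \<in> D k" and A: "A0 \<in> sets M" "\<And>j. A j \<in> sets M"
    show "(\<lambda>k. multi_corr M T A0 A (g k)) \<longlonglongrightarrow> measure M A0 * (\<Prod>j\<in>UNIV. measure M (A j))"
    proof (rule multi_corr_tendsto_from_generator[OF G(2-5) _ A])
      fix A0 and A :: "'l \<Rightarrow> 'x set" assume "A0 \<in> G" "\<And>j. A j \<in> G"
      then have "\<exists>n. A0 = e n" "\<forall>j. \<exists>n. A j = e n" using e by (metis imageE)+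
      then obtain n0 n where n: "A0 = e n0" "\<And>j. A j = e (n j)" by metis
      let ?p = "measure M A0 * (\<Prod>j\<in>UNIV. measure M (A j))"
      define N where "N = Max (insert n0 (range n))"
      have "n0 \<le> N" "n j \<le> N" for j unfolding N_def by (intro Max_ge; simp)+
      then have "(n0, n) \<in> {..k} \<times> (UNIV \<rightarrow>\<^sub>E {..k})" if "k \<ge> N" for k
        using that by (auto intro: order_trans)
      then have "g k \<in> R_set M T (1 / real (Suc k)) A0 A" if "k \<ge> N" for k
        using g[of k] that unfolding D_def n(1) n(2)[abs_def] by force
      then have close: "\<bar>multi_corr M T A0 A (g k) - ?p\<bar> < 1 / real (Suc k)" if "k \<ge> N" for k
        using that unfolding R_set_def by blast
      have "(\<lambda>k. multi_corr M T A0 A (g k) - ?p) \<longlonglongrightarrow> 0"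
      proof (rule Lim_null_comparison)
        show "\<forall>\<^sub>F k in sequentially. norm (multi_corr M T A0 A (g k) - ?p) \<le> 1 / real (Suc k)"
          using eventually_ge_at_top[of N] by eventually_elim (use close in \<open>simp add: less_imp_le\<close>)
        show "(\<lambda>k. 1 / real (Suc k)) \<longlonglongrightarrow> 0"
          using LIMSEQ_inverse_real_of_nat by (simp add: inverse_eq_divide)
      qed
      then show "(\<lambda>k. multi_corr M T A0 A (g k)) \<longlonglongrightarrow> ?p" by (simp add: LIM_zero_iff)
    qed
  qed
qed

end

context mp_action
begin

lemma multi_corr_single:
  fixes g :: "'g^'l::finite"
  assumes "A0 \<in> sets M" "A \<in> sets M"
  shows "multi_corr M T A0 ((\<lambda>_. space M)(j := A)) g = measure M (A0 \<inter> T (g $ j) ` A)"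
proof -
  have "A0 \<inter> (\<Inter>i. T (g $ i) ` ((\<lambda>_. space M)(j := A)) i) = A0 \<inter> T (g $ j) ` A"
    using sets.sets_into_space[OF assms(1)] by (auto simp: T_image_space split: if_splits)
  then show ?thesis by (simp add: multi_corr_def)
qed

lemma prod_measure_single:
  "(\<Prod>i\<in>(UNIV :: 'l::finite set). measure M (((\<lambda>_. space M)(j := A)) i)) = measure M A"
  by (subst prod.remove[of UNIV j]) (auto simp: prob_space)

lemma mixing_property_single:
  fixes g :: "nat \<Rightarrow> 'g^'l::finite"
  assumes lim: "\<And>A0 A. A0 \<in> sets M \<Longrightarrow> (\<And>j. A j \<in> sets M) \<Longrightarrow>
      (\<lambda>k. multi_corr M T A0 A (g k)) \<longlonglongrightarrow> measure M A0 * (\<Prod>j\<in>UNIV. measure M (A j))"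
  shows "mixing_property M (\<lambda>k. T (g k $ j))"
  unfolding mixing_property_def
proof (intro ballI)
  fix A B assume AB: "A \<in> sets M" "B \<in> sets M"
  have "(\<lambda>k. multi_corr M T B ((\<lambda>_. space M)(j := A)) (g k)) \<longlonglongrightarrow> measure M B * measure M A"
    using lim[of B "(\<lambda>_. space M)(j := A)"] AB unfolding prod_measure_single by auto
  then show "(\<lambda>k. measure M (A \<inter> (T (g k $ j) -` B \<inter> space M))) \<longlonglongrightarrow> measure M A * measure M B"
    using AB by (simp add: multi_corr_single T_vimage_eq measure_T_shift[of B A] mult.commute)
qed

text \<open>
  By invariance the correlation with \<open>A\<close> in position \<open>j\<close>, \<open>B\<close> in position \<open>i\<close>, and the whole space
  elsewhere, depends only on the difference of the two group elements.
\<close>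
lemma mixing_property_difference:
  fixes g :: "nat \<Rightarrow> 'g^'l::finite"
  assumes lim: "\<And>A0 A. A0 \<in> sets M \<Longrightarrow> (\<And>j. A j \<in> sets M) \<Longrightarrow>
      (\<lambda>k. multi_corr M T A0 A (g k)) \<longlonglongrightarrow> measure M A0 * (\<Prod>j\<in>UNIV. measure M (A j))"
    and ij: "i \<noteq> j"
  shows "mixing_property M (\<lambda>k. T (g k $ j - g k $ i))"
  unfolding mixing_property_def
proof (intro ballI)
  fix A B assume AB: "A \<in> sets M" "B \<in> sets M"
  let ?A = "(\<lambda>_. space M)(i := B, j := A)"
  have "multi_corr M T (space M) ?A h = measure M (A \<inter> (T (h $ j - h $ i) -` B \<inter> space M))" for h
  proof -
    have "space M \<inter> (\<Inter>l. T (h $ l) ` ?A l) = T (h $ i) ` B \<inter> T (h $ j) ` A"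
    proof -
      have "T (h $ l) ` ?A l = (if l = j then T (h $ j) ` A else if l = i then T (h $ i) ` B else space M)" for l
        by (simp add: T_image_space)
      moreover have "space M \<inter> (\<Inter>l. if l = j then Y else if l = i then X else space M) = X \<inter> Y"
        if "X \<subseteq> space M" "Y \<subseteq> space M" for X Y
        using that ij by (auto split: if_splits)
      ultimately show ?thesis
        using AB[THEN T_image_sets, THEN sets.sets_into_space] by (simp only:)
    qed
    then have "multi_corr M T (space M) ?A h = measure M (T (h $ i) ` B \<inter> T (h $ j) ` A)"
      by (simp add: multi_corr_def)
    also have "\<dots> = measure M (A \<inter> T (- (h $ j)) ` T (h $ i) ` B)"
      using AB by (intro measure_T_shift) auto
    also have "T (- (h $ j)) ` T (h $ i) ` B = T (h $ j - h $ i) -` B \<inter> space M"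
      using AB by (simp add: T_image_image T_vimage_eq)
    finally show ?thesis .
  qed
  moreover have "(\<lambda>k. multi_corr M T (space M) ?A (g k)) \<longlonglongrightarrow> measure M (space M) * (\<Prod>l\<in>UNIV. measure M (?A l))"
    by (rule lim) (use AB in auto)
  moreover have "(\<Prod>l\<in>UNIV. measure M (?A l)) = measure M A * measure M B"
    using ij by (subst prod.remove[of UNIV j], simp, simp, subst prod.remove[of _ i]) (auto simp: prob_space)
  ultimately show "(\<lambda>k. measure M (A \<inter> (T (g k $ j - g k $ i) -` B \<inter> space M))) \<longlonglongrightarrow> measure M A * measure M B"
    by (simp add: prob_space)
qed

lemma mixing_property_imp_weakly_mixing:
  assumes "mixing_property M (\<lambda>k. T (g k))"
  shows "weakly_mixing M T"
proof (rule mixing_sequence_imp_weakly_mixing[of "\<lambda>k. - g k"])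
  fix A B assume "A \<in> sets M" "B \<in> sets M"
  then show "(\<lambda>k. measure M (A \<inter> T (- g k) ` B)) \<longlonglongrightarrow> measure M A * measure M B"
    using assms by (simp add: mixing_property_def T_vimage_eq)
qed

lemma multi_corr_limits_imp_weakly_mixing:
  fixes g :: "nat \<Rightarrow> 'g^'l::finite"
  assumes "\<And>A0 A. A0 \<in> sets M \<Longrightarrow> (\<And>j. A j \<in> sets M) \<Longrightarrow>
      (\<lambda>k. multi_corr M T A0 A (g k)) \<longlonglongrightarrow> measure M A0 * (\<Prod>j\<in>UNIV. measure M (A j))"
  shows "weakly_mixing M T"
  by (rule mixing_property_imp_weakly_mixing) (rule mixing_property_single[OF assms])

end

text \<open>
  The set \<open>D k\<close> keeps the coordinates and their differences away from the first \<open>k\<close> elements of the group.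
\<close>
lemma escape_test_sets:
  assumes count: "countable (UNIV :: 'g::ab_group_add set)" and inf: "infinite (UNIV :: 'g set)"
  obtains D :: "nat \<Rightarrow> ('g::ab_group_add^'l::finite) set" where "\<And>k. full_density (D k)"
    "\<And>(g :: nat \<Rightarrow> 'g^'l) j. (\<And>k. g k \<in> D k) \<Longrightarrow> tends_to_infinity (\<lambda>k. g k $ j)"
    "\<And>(g :: nat \<Rightarrow> 'g^'l) i j. (\<And>k. g k \<in> D k) \<Longrightarrow> i \<noteq> j \<Longrightarrow> tends_to_infinity (\<lambda>k. g k $ i - g k $ j)"
proof -
  define e where "e = from_nat_into (UNIV :: 'g set)"
  have e: "range e = UNIV" unfolding e_def using count by (intro range_from_nat_into) auto
  have tends: "tends_to_infinity h" if h: "\<And>k. h k \<notin> e ` {..<k}" for h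
    unfolding tends_to_infinity_def
  proof (intro allI impI)
    fix S :: "'g set" assume "finite S"
    have "\<forall>s\<in>S. \<forall>\<^sub>F k in sequentially. h k \<noteq> s"
    proof
      fix s
      obtain n where n: "s = e n" using e by (metis UNIV_I imageE)
      show "\<forall>\<^sub>F k in sequentially. h k \<noteq> s"
        using eventually_gt_at_top[of n] by eventually_elim (use h n in auto)
    qed
    then have "\<forall>\<^sub>F k in sequentially. \<forall>s\<in>S. h k \<noteq> s"
      by (intro eventually_ball_finite \<open>finite S\<close>)
    then show "\<forall>\<^sub>F k in sequentially. h k \<notin> S" by eventually_elim blast
  qed
  define D :: "nat \<Rightarrow> ('g^'l) set" where
    "D k = (\<Inter>j. {g. g $ j \<notin> e ` {..<k}}) \<inter> (\<Inter>p\<in>{p. fst p \<noteq> snd p}. {g. g $ fst p - g $ snd p \<notin> e ` {..<k}})" for k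
  show thesis
  proof (rule that[of D])
    show "full_density (D k)" for k
      unfolding D_def
    proof (intro full_density_Int full_density_INT)
      show "full_density {g :: 'g^'l. g $ j \<notin> e ` {..<k}}" for j
        by (rule full_density_avoid_finite[OF inf, where j = j]) auto
      show "full_density {g :: 'g^'l. g $ fst p - g $ snd p \<notin> e ` {..<k}}" if "p \<in> {p. fst p \<noteq> snd p}" for p
        by (rule full_density_avoid_finite[OF inf, where j = "fst p"]) (use that in \<open>auto simp: axis_def\<close>)
    qed auto
    fix g :: "nat \<Rightarrow> 'g^'l" and i j :: 'l assume g: "\<And>k. g k \<in> D k"
    show "tends_to_infinity (\<lambda>k. g k $ j)"
      by (rule tends) (use g in \<open>auto simp: D_def\<close>)
    assume "i \<noteq> j"
    then show "tends_to_infinity (\<lambda>k. g k $ i - g k $ j)"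
      by (intro tends) (use g in \<open>auto simp: D_def\<close>)
  qed
qed

section \<open>The equivalences\<close>

context mp_system
begin

interpretation mp_action M T by (rule is_mp_action)

text \<open>
  Taking every summand with index \<open>k\<close> from the \<open>k\<close>-th test sets makes all correlations converge and all
  coordinates and differences escape, separately for each position \<open>t\<close>.
\<close>
lemma weakly_mixing_imp_mixing_sequences:
  fixes F :: "nat \<Rightarrow> ('g^'l::finite) set"
  assumes count: "countable (UNIV :: 'g set)" and inf: "infinite (UNIV :: 'g set)" and wm: "weakly_mixing M T"
    and F: "folner_seq F" and E: "upper_density F E > 0" and m: "m \<ge> 1"
  shows "\<exists>g :: 'l \<Rightarrow> nat \<Rightarrow> nat \<Rightarrow> 'g.
             (\<forall>j. non_degenerated m (g j)) \<and>
             (\<forall>i j. i \<noteq> j \<longrightarrow> essentially_distinct m (g i) (g j)) \<and>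
             {(\<chi> j. set_sum m (g j) \<alpha>) | \<alpha>. \<alpha> \<in> msubsets m} \<subseteq> E \<and>
             (\<forall>t\<in>{1..m}. \<forall>j. mixing_property M (\<lambda>k. T (g j k t))) \<and>
             (\<forall>t\<in>{1..m}. \<forall>i j. i \<noteq> j \<longrightarrow>
                mixing_property M (\<lambda>k. T (g j k t - g i k t)))"
proof -
  obtain D1 :: "nat \<Rightarrow> ('g^'l) set" where D1: "\<And>k. full_density (D1 k)"
    "\<And>(g :: nat \<Rightarrow> 'g^'l) A0 A. (\<And>k. g k \<in> D1 k) \<Longrightarrow> A0 \<in> sets M \<Longrightarrow> (\<And>j. A j \<in> sets M) \<Longrightarrow>
      (\<lambda>k. multi_corr M T A0 A (g k)) \<longlonglongrightarrow> measure M A0 * (\<Prod>j\<in>UNIV. measure M (A j))"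
    using mixing_test_sets[OF weakly_mixing_imp_R_set_full_density[OF count wm]] by blast
  obtain D2 :: "nat \<Rightarrow> ('g^'l) set" where D2: "\<And>k. full_density (D2 k)"
    "\<And>(g :: nat \<Rightarrow> 'g^'l) j. (\<And>k. g k \<in> D2 k) \<Longrightarrow> tends_to_infinity (\<lambda>k. g k $ j)"
    "\<And>(g :: nat \<Rightarrow> 'g^'l) i j. (\<And>k. g k \<in> D2 k) \<Longrightarrow> i \<noteq> j \<Longrightarrow> tends_to_infinity (\<lambda>k. g k $ i - g k $ j)"
    using escape_test_sets[OF count inf] by blast
  obtain v :: "nat \<Rightarrow> nat \<Rightarrow> 'g^'l" where v: "\<And>k t. t \<in> {1..m} \<Longrightarrow> v k t \<in> D1 k \<inter> D2 k"
      "\<And>\<alpha>. \<alpha> \<in> msubsets m \<Longrightarrow> set_sum m v \<alpha> \<in> E"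
    by (rule positive_upper_density_contains_sums[OF m F E, of "\<lambda>k. D1 k \<inter> D2 k"])
       (use full_density_Int D1(1) D2(1) in blast)+
  define g where "g j k t = v k t $ j" for j k t
  have "(\<chi> j. set_sum m (g j) \<alpha>) = set_sum m v \<alpha>" for \<alpha>
    by (simp add: vec_eq_iff set_sum_def g_def)
  then have "{(\<chi> j. set_sum m (g j) \<alpha>) | \<alpha>. \<alpha> \<in> msubsets m} \<subseteq> E" using v(2) by auto
  moreover have "\<forall>j. non_degenerated m (g j)"
    using D2(2) v(1) by (auto simp: non_degenerated_def g_def)
  moreover have "\<forall>i j. i \<noteq> j \<longrightarrow> essentially_distinct m (g i) (g j)"
    using D2(3) v(1) by (auto simp: essentially_distinct_def g_def)
  moreover have lim: "(\<lambda>k. multi_corr M T A0 A (v k t)) \<longlonglongrightarrow> measure M A0 * (\<Prod>j\<in>UNIV. measure M (A j))"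
    if "t \<in> {1..m}" "A0 \<in> sets M" "\<And>j. A j \<in> sets M" for t A0 A
    by (rule D1(2)) (use v(1) that in auto)
  moreover have "\<forall>t\<in>{1..m}. \<forall>j. mixing_property M (\<lambda>k. T (g j k t))"
    unfolding g_def by (intro ballI allI mixing_property_single lim)
  moreover have "\<forall>t\<in>{1..m}. \<forall>i j. i \<noteq> j \<longrightarrow> mixing_property M (\<lambda>k. T (g j k t - g i k t))"
    unfolding g_def by (intro ballI allI impI mixing_property_difference lim)
  ultimately show ?thesis by blast
qed

lemma R_sets_full_density_imp_correlation_limits:
  fixes F :: "nat \<Rightarrow> ('g^'l::finite) set"
  assumes R: "\<And>A0 (A :: 'l \<Rightarrow> 'x set) \<epsilon>. A0 \<in> sets M \<Longrightarrow> (\<And>j. A j \<in> sets M) \<Longrightarrow> \<epsilon> > 0 \<Longrightarrow>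
      full_density (R_set M T \<epsilon> A0 A)"
    and F: "folner_seq F" and E: "upper_density F E > 0"
  shows "\<exists>v :: nat \<Rightarrow> 'g^'l. (\<forall>k. v k \<in> E) \<and> (\<forall>A0\<in>sets M. \<forall>A. (\<forall>j. A j \<in> sets M) \<longrightarrow>
      (\<lambda>k. multi_corr M T A0 A (v k)) \<longlonglongrightarrow> measure M A0 * (\<Prod>j\<in>UNIV. measure M (A j)))"
proof -
  obtain D :: "nat \<Rightarrow> ('g^'l) set" where D: "\<And>k. full_density (D k)"
    "\<And>(g :: nat \<Rightarrow> 'g^'l) A0 A. (\<And>k. g k \<in> D k) \<Longrightarrow> A0 \<in> sets M \<Longrightarrow> (\<And>j. A j \<in> sets M) \<Longrightarrow>
      (\<lambda>k. multi_corr M T A0 A (g k)) \<longlonglongrightarrow> measure M A0 * (\<Prod>j\<in>UNIV. measure M (A j))"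
    using mixing_test_sets[OF R] by blast
  have "\<exists>v. v \<in> E \<inter> D k" for k
    using positive_upper_density_meets_full_density[OF F E D(1)] by blast
  then obtain v where v: "\<And>k. v k \<in> E \<inter> D k" by metis
  then show ?thesis using D(2)[of v] by (intro exI[of _ v]) auto
qed

end

lemma R_lim_1I:
  assumes "(\<lambda>k. x {k}) \<longlonglongrightarrow> L"
  shows "R_lim 1 x L"
  unfolding R_lim_def
proof (intro allI impI)
  fix \<epsilon> :: real assume "\<epsilon> > 0"
  then obtain N where N: "\<And>k. k \<ge> N \<Longrightarrow> dist (x {k}) L < \<epsilon>"
    using assms by (auto simp: tendsto_iff eventually_sequentially)
  show "\<exists>\<alpha>0\<in>msubsets 1. \<forall>\<alpha>\<in>msubsets 1. Min \<alpha> > Max \<alpha>0 \<longrightarrow> dist (x \<alpha>) L < \<epsilon>"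
  proof (intro bexI ballI impI)
    show "{Suc N} \<in> msubsets 1" by (simp add: msubsets_def)
    fix \<alpha> assume "\<alpha> \<in> msubsets 1" "Min \<alpha> > Max {Suc N}"
    moreover from this obtain k where "\<alpha> = {k}" using msubsets_1 by blast
    ultimately show "dist (x \<alpha>) L < \<epsilon>" using N by simp
  qed
qed

text \<open>
  The blocks \<open>{k + 1..k + m}\<close> turn a limit over index sets into a limit of an ordinary sequence.
\<close>
lemma R_lim_imp_tendsto:
  assumes "R_lim m x L" "m \<ge> 1"
  shows "(\<lambda>k. x {k + 1..k + m}) \<longlonglongrightarrow> L"
  unfolding tendsto_iff
proof (intro allI impI)
  fix \<epsilon> :: real assume "\<epsilon> > 0"
  then obtain \<alpha>0 where \<alpha>0: "\<And>\<alpha>. \<alpha> \<in> msubsets m \<Longrightarrow> Min \<alpha> > Max \<alpha>0 \<Longrightarrow> dist (x \<alpha>) L < \<epsilon>"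
    using assms(1) unfolding R_lim_def by blast
  show "\<forall>\<^sub>F k in sequentially. dist (x {k + 1..k + m}) L < \<epsilon>"
    using eventually_ge_at_top[of "Max \<alpha>0"]
  proof eventually_elim
    case (elim k)
    have "Min {k + 1..k + m} = k + 1" using assms(2) by (intro Min_eqI) auto
    moreover have "{k + 1..k + m} \<in> msubsets m" by (auto simp: msubsets_def)
    ultimately show ?case using \<alpha>0 elim by simp
  qed
qed

text \<open>
  In (i) \<open>\<Longrightarrow>\<close> (iii) the sums have a single summand, \<open>m = 1\<close>. In the converse directions \<open>E\<close> is the whole
  group \<open>G\<^sup>l\<close>, and \<open>F0\<close> is any Folner sequence of it.
\<close>
theorem theorem6p10:
  fixes M :: "'x::metric_space measure"
    and T :: "'g::ab_group_add \<Rightarrow> 'x \<Rightarrow> 'x"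
  assumes "countable (UNIV :: 'g set)"
    and "infinite (UNIV :: 'g set)"
    and "mp_system M T"
  shows
    "(weakly_mixing M T \<longleftrightarrow>
       (\<forall>(F :: nat \<Rightarrow> ('g^'l::finite) set) E m.
          folner_seq F \<and> upper_density F E > 0 \<and> m \<ge> 1 \<longrightarrow>
          (\<exists>g :: 'l \<Rightarrow> nat \<Rightarrow> nat \<Rightarrow> 'g.
             (\<forall>j. non_degenerated m (g j)) \<and>
             (\<forall>i j. i \<noteq> j \<longrightarrow> essentially_distinct m (g i) (g j)) \<and>
             {(\<chi> j. set_sum m (g j) \<alpha>) | \<alpha>. \<alpha> \<in> msubsets m} \<subseteq> E \<and>
             (\<forall>t\<in>{1..m}. \<forall>j. mixing_property M (\<lambda>k. T (g j k t))) \<and>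
             (\<forall>t\<in>{1..m}. \<forall>i j. i \<noteq> j \<longrightarrow>
                mixing_property M (\<lambda>k. T (g j k t - g i k t)))))) \<and>
     (weakly_mixing M T \<longleftrightarrow>
       (\<forall>(F :: nat \<Rightarrow> ('g^'l) set) E.
          folner_seq F \<and> upper_density F E > 0 \<longrightarrow>
          (\<exists>m\<ge>1. \<exists>g :: 'l \<Rightarrow> nat \<Rightarrow> nat \<Rightarrow> 'g.
             {(\<chi> j. set_sum m (g j) \<alpha>) | \<alpha>. \<alpha> \<in> msubsets m} \<subseteq> E \<and>
             (\<forall>A0\<in>sets M. \<forall>A :: 'l \<Rightarrow> 'x set. (\<forall>j. A j \<in> sets M) \<longrightarrow>
                R_lim m (\<lambda>\<alpha>. multi_corr M T A0 A (\<chi> j. set_sum m (g j) \<alpha>))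
                  (measure M A0 * (\<Prod>j\<in>UNIV. measure M (A j))))))) \<and>
     (weakly_mixing M T \<longleftrightarrow>
       (\<forall>A0\<in>sets M. \<forall>A :: 'l \<Rightarrow> 'x set. \<forall>\<epsilon>>0. (\<forall>j. A j \<in> sets M) \<longrightarrow>
          uniform_density_one (R_set M T \<epsilon> A0 A)))"
  (is "(?i \<longleftrightarrow> ?ii) \<and> (?i \<longleftrightarrow> ?iii) \<and> (?i \<longleftrightarrow> ?iv)")
proof -
  interpret mp_system M T by fact
  interpret mp_action M T by (rule is_mp_action)
  note count = assms(1) and inf = assms(2)
  have "countable (UNIV :: ('g^'l) set)"
  proof -
    have "countable (range (vec_nth :: 'g^'l \<Rightarrow> 'l \<Rightarrow> 'g))"
      using countable_PiE[of "UNIV :: 'l set" "\<lambda>_. UNIV :: 'g set"] count by (auto intro: countable_subset)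
    moreover have "inj (vec_nth :: 'g^'l \<Rightarrow> 'l \<Rightarrow> 'g)" by (simp add: inj_def vec_nth_inject)
    ultimately show ?thesis by (rule countable_image_inj_on)
  qed
  then obtain F0 :: "nat \<Rightarrow> ('g^'l) set" where F0: "folner_seq F0" by (rule folner_seq_exists)
  have UNIV_pos: "upper_density F0 UNIV > 0"
  proof -
    have "uniform_density_one (UNIV :: ('g^'l) set)"
      by (simp add: uniform_density_one_iff_full_density full_density_UNIV)
    then show ?thesis using F0 by (simp add: uniform_density_one_def)
  qed
  have i_imp_iv: ?iv if ?i
    unfolding uniform_density_one_iff_full_density
    by (intro ballI allI impI weakly_mixing_imp_R_set_full_density[OF count that]) auto
  have sequence: "\<exists>v :: nat \<Rightarrow> 'g^'l. (\<forall>k. v k \<in> E) \<and> (\<forall>A0\<in>sets M. \<forall>A. (\<forall>j. A j \<in> sets M) \<longrightarrow>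
      (\<lambda>k. multi_corr M T A0 A (v k)) \<longlonglongrightarrow> measure M A0 * (\<Prod>j\<in>UNIV. measure M (A j)))"
    if iv: ?iv and "folner_seq F" "upper_density F E > 0" for F :: "nat \<Rightarrow> ('g^'l) set" and E
  proof (rule R_sets_full_density_imp_correlation_limits[OF _ that(2,3)])
    fix A0 and A :: "'l \<Rightarrow> 'x set" and \<epsilon> :: real
    assume "A0 \<in> sets M" "\<And>j. A j \<in> sets M" "\<epsilon> > 0"
    then show "full_density (R_set M T \<epsilon> A0 A)"
      using iv by (simp add: uniform_density_one_iff_full_density)
  qed

  have i_imp_ii: "?ii" if "?i"
    using weakly_mixing_imp_mixing_sequences[OF count inf that] by blast
  have ii_imp_i: "?i" if ii: "?ii"
  proof -
    obtain g :: "'l \<Rightarrow> nat \<Rightarrow> nat \<Rightarrow> 'g" where "\<forall>t\<in>{1..1}. \<forall>j. mixing_property M (\<lambda>k. T (g j k t))"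
      using ii[rule_format, of F0 UNIV 1, OF conjI[OF F0 conjI[OF UNIV_pos order_refl]]]
      by (elim exE conjE) (rule that)
    then show ?i by (intro mixing_property_imp_weakly_mixing[of "\<lambda>k. g undefined k 1"]) auto
  qed
  have i_imp_iii: "?iii" if wm: "?i"
  proof (intro allI impI, elim conjE)
    fix F :: "nat \<Rightarrow> ('g^'l) set" and E assume F: "folner_seq F" "upper_density F E > 0"
    obtain v :: "nat \<Rightarrow> 'g^'l" where v: "\<forall>k. v k \<in> E"
      "\<forall>A0\<in>sets M. \<forall>A. (\<forall>j. A j \<in> sets M) \<longrightarrow>
        (\<lambda>k. multi_corr M T A0 A (v k)) \<longlonglongrightarrow> measure M A0 * (\<Prod>j\<in>UNIV. measure M (A j))"
      using sequence[OF i_imp_iv[OF wm] F]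
      by (elim exE conjE) (rule that)
    let ?g = "\<lambda>j k (t :: nat). v k $ j"
    have sum: "(\<chi> j. set_sum 1 (?g j) {k}) = v k" for k by (simp add: set_sum_def vec_eq_iff)
    have "(\<chi> j. set_sum 1 (?g j) \<alpha>) \<in> E" if \<alpha>: "\<alpha> \<in> msubsets 1" for \<alpha>
    proof -
      obtain k where "\<alpha> = {k}" using msubsets_1[OF \<alpha>] by blast
      then show ?thesis by (simp only: sum v(1))
    qed
    then have "{(\<chi> j. set_sum 1 (?g j) \<alpha>) | \<alpha>. \<alpha> \<in> msubsets 1} \<subseteq> E" by blast
    moreover have "R_lim 1 (\<lambda>\<alpha>. multi_corr M T A0 A (\<chi> j. set_sum 1 (?g j) \<alpha>)) (measure M A0 * (\<Prod>j\<in>UNIV. measure M (A j)))"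
      if "A0 \<in> sets M" "\<forall>j. A j \<in> sets M" for A0 and A :: "'l \<Rightarrow> 'x set"
      by (rule R_lim_1I) (use v(2) that sum in simp)
    ultimately show "\<exists>m\<ge>1. \<exists>g :: 'l \<Rightarrow> nat \<Rightarrow> nat \<Rightarrow> 'g.
             {(\<chi> j. set_sum m (g j) \<alpha>) | \<alpha>. \<alpha> \<in> msubsets m} \<subseteq> E \<and>
             (\<forall>A0\<in>sets M. \<forall>A :: 'l \<Rightarrow> 'x set. (\<forall>j. A j \<in> sets M) \<longrightarrow>
                R_lim m (\<lambda>\<alpha>. multi_corr M T A0 A (\<chi> j. set_sum m (g j) \<alpha>))
                  (measure M A0 * (\<Prod>j\<in>UNIV. measure M (A j))))"
      by (intro exI[of _ "1::nat"] exI[of _ ?g] conjI) auto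
  qed
  have iii_imp_i: "?i" if iii: "?iii"
  proof -
    obtain m and g :: "'l \<Rightarrow> nat \<Rightarrow> nat \<Rightarrow> 'g" where m: "m \<ge> 1"
      and g: "\<forall>A0\<in>sets M. \<forall>A :: 'l \<Rightarrow> 'x set. (\<forall>j. A j \<in> sets M) \<longrightarrow>
        R_lim m (\<lambda>\<alpha>. multi_corr M T A0 A (\<chi> j. set_sum m (g j) \<alpha>)) (measure M A0 * (\<Prod>j\<in>UNIV. measure M (A j)))"
      using iii[rule_format, of F0 UNIV, OF conjI[OF F0 UNIV_pos]]
      by (elim exE conjE) (rule that)
    have "(\<lambda>k. multi_corr M T A0 A (\<chi> j. set_sum m (g j) {k + 1..k + m})) \<longlonglongrightarrow> measure M A0 * (\<Prod>j\<in>UNIV. measure M (A j))"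
      if "A0 \<in> sets M" "\<And>j. A j \<in> sets M" for A0 and A :: "'l \<Rightarrow> 'x set"
      using R_lim_imp_tendsto[OF g[rule_format, OF that] m] .
    then show ?i
      by (rule multi_corr_limits_imp_weakly_mixing[of "\<lambda>k. \<chi> j. set_sum m (g j) {k + 1..k + m}"])
  qed
  have iv_imp_i: "?i" if iv: "?iv"
  proof -
    obtain v :: "nat \<Rightarrow> 'g^'l" where
      v: "\<forall>A0\<in>sets M. \<forall>A. (\<forall>j. A j \<in> sets M) \<longrightarrow>
        (\<lambda>k. multi_corr M T A0 A (v k)) \<longlonglongrightarrow> measure M A0 * (\<Prod>j\<in>UNIV. measure M (A j))"
      using sequence[OF iv F0 UNIV_pos]
      by (elim exE conjE) (rule that)
    show ?i by (rule multi_corr_limits_imp_weakly_mixing[of v]) (use v in auto)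
  qed
  show ?thesis
    by (intro conjI iffI)
       (erule i_imp_ii ii_imp_i i_imp_iii iii_imp_i i_imp_iv iv_imp_i)+
qed

end
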